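(* Let $\Omega\subset\mathbb{R}^N$ be a bounded domain, let $f$ satisfy (f1) and (f2) with $\sigma>0$, and let $u\in W^{1,\infty}_0(\Omega)$ be a solution of $\inf\{\mathcal{I}_\Omega(v): v\in W^{1,\infty}_0(\Omega)\}$. Then (i) $|\{x\in\Omega: |Du(x)|>\sigma\}|>0$; (ii) $u$ is the unique solution of this minimization problem.
   Context: $\mathcal{I}_\Omega(v)=\int_\Omega [f(|Dv|)-v]\,dx$. (f1) $f\in C^1([0,\infty))$ is convex, monotone nondecreasing, $f(0)=0$ and $\lim_{s\to\infty}f(s)/s=+\infty$; (f2) there exists $\sigma\ge0$ with $f'(s)=0$ for $0\le s\le\sigma$, $f'(s)>0$ for $s>\sigma$, $f\in C^{2,\alpha}(\sigma,\infty)$ for some $0<\alpha<1$, and $f''(s)>0$ for $s>\sigma$. *)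

theory Defs
  imports "HOL-Analysis.Analysis"
begin

text \<open>Classical (a.e.) gradient; for Lipschitz functions it exists almost everywhere
  (Rademacher) and coincides with the weak gradient. Set to 0 where v is not differentiable.\<close>
definition grad :: "(real^'n \<Rightarrow> real) \<Rightarrow> real^'n \<Rightarrow> real^'n" where
  "grad v x = (if v differentiable (at x)
               then (\<chi> i. frechet_derivative v (at x) (axis i 1)) else 0)"

text \<open>W^{1,\<infinity>}_0(\<Omega>): functions on R^N that are Lipschitz and vanish outside \<Omega>
  (i.e. Lipschitz functions on the closure of \<Omega> vanishing on the boundary, extended by zero).\<close>
definition W1inf0 :: "(real^'n) set \<Rightarrow> (real^'n \<Rightarrow> real) set" where
  "W1inf0 \<Omega> = {v. (\<exists>L. L-lipschitz_on UNIV v) \<and> (\<forall>x. x \<notin> \<Omega> \<longrightarrow> v x = 0)}"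

definition I_Omega :: "(real \<Rightarrow> real) \<Rightarrow> (real^'n) set \<Rightarrow> (real^'n \<Rightarrow> real) \<Rightarrow> real" where
  "I_Omega f \<Omega> v = (\<integral>x. (f (norm (grad v x)) - v x) \<partial>(lebesgue_on \<Omega>))"

definition is_minimizer :: "(real \<Rightarrow> real) \<Rightarrow> (real^'n) set \<Rightarrow> (real^'n \<Rightarrow> real) \<Rightarrow> bool" where
  "is_minimizer f \<Omega> u \<longleftrightarrow> u \<in> W1inf0 \<Omega> \<and> (\<forall>v \<in> W1inf0 \<Omega>. I_Omega f \<Omega> u \<le> I_Omega f \<Omega> v)"

definition cond_f1 :: "(real \<Rightarrow> real) \<Rightarrow> (real \<Rightarrow> real) \<Rightarrow> bool" where
  "cond_f1 f f' \<longleftrightarrow>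
     (\<forall>s\<ge>0. (f has_real_derivative f' s) (at s within {0..})) \<and> continuous_on {0..} f' \<and>
     convex_on {0..} f \<and> mono_on {0..} f \<and> f 0 = 0 \<and>
     filterlim (\<lambda>s. f s / s) at_top at_top"

text \<open>(f2), with f \<in> C^{2,\<alpha>}(\<sigma>,\<infinity>) read as: f'' exists on (\<sigma>,\<infinity>) and is
  \<alpha>-Hoelder continuous on every compact subinterval.\<close>
definition cond_f2 :: "(real \<Rightarrow> real) \<Rightarrow> (real \<Rightarrow> real) \<Rightarrow> real \<Rightarrow> bool" where
  "cond_f2 f f' \<sigma> \<longleftrightarrow> \<sigma> \<ge> 0 \<and>
     (\<forall>s. 0 \<le> s \<and> s \<le> \<sigma> \<longrightarrow> f' s = 0) \<and> (\<forall>s>\<sigma>. f' s > 0) \<and>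
     (\<exists>\<alpha> f''. 0 < \<alpha> \<and> \<alpha> < 1 \<and>
        (\<forall>s>\<sigma>. (f' has_real_derivative f'' s) (at s)) \<and>
        (\<forall>a b. \<sigma> < a \<and> a \<le> b \<longrightarrow>
            (\<exists>C. \<forall>x\<in>{a..b}. \<forall>y\<in>{a..b}. \<bar>f'' x - f'' y\<bar> \<le> C * \<bar>x - y\<bar> powr \<alpha>)) \<and>
        (\<forall>s>\<sigma>. f'' s > 0))"

end

theory Submission
  imports Defs
begin

text \<open>Uniqueness: the midpoint of two minimizers \<open>u\<close>, \<open>w\<close> cannot have smaller energy, and the
  density \<open>f\<close> is strictly convex beyond its flat part \<open>[0, \<sigma>]\<close>, so \<open>f(|Du|) = f(|Dw|)\<close> almost everywhere
  and hence all minimizers have the same integral. Since \<open>I(max u w) + I(min u w) \<le> I(u) + I(w)\<close>, the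
  function \<open>max u w\<close> is again a minimizer; it dominates \<open>u\<close> and has the same integral, so it equals
  \<open>u\<close>, and likewise \<open>w\<close>.

  Steepness: if \<open>|Du| \<le> \<sigma>\<close> almost everywhere, then \<open>I(u) = - \<integral> u\<close>, and comparison with \<open>\<sigma>\<close> times the
  distance to the complement of \<open>\<Omega>\<close> shows \<open>\<integral> u > 0\<close>. As \<open>f'(\<sigma>) = 0\<close>, the energy of \<open>(1 + t) u\<close> is
  \<open>- (1 + t) \<integral> u + o(t)\<close>, which is smaller than \<open>I(u)\<close> for small \<open>t > 0\<close>.

  Both arguments compute gradients pointwise almost everywhere and therefore rest on Rademacher's
  theorem.\<close>

section \<open>Covering arguments\<close>

text \<open>Vitali's theorem selects from the fine cover countably many disjoint closed balls that
  exhaust \<open>S\<close> up to a null set. Spheres are null, so the open balls exhaust it too, and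
  the comparison is summed over them. The point \<open>x\<close> may lie off the centre of its ball,
  which admits intervals having \<open>x\<close> as an endpoint; \<open>V\<close> is open, so it can
  be the ambient set of a further application.\<close>

lemma Vitali_compare_measures:
  fixes \<mu> \<nu> :: "'a::euclidean_space measure"
  assumes sets: "sets \<mu> = sets borel" "sets \<nu> = sets borel"
    and U: "open U" "S \<subseteq> U"
    and small: "\<And>x d. \<lbrakk>x \<in> S; 0 < d\<rbrakk> \<Longrightarrow>
      \<exists>a r. 0 < r \<and> r < d \<and> x \<in> cball a r \<and> emeasure \<mu> (ball a r) \<le> emeasure \<nu> (ball a r)"
  obtains V where "open V" "V \<subseteq> U" "negligible (S - V)" "emeasure \<mu> V \<le> emeasure \<nu> V"
proof -
  define K where "K = {(a,r). 0 < r \<and> ball a r \<subseteq> U \<and> emeasure \<mu> (ball a r) \<le> emeasure \<nu> (ball a r)}"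
  have cover: "\<exists>i. i \<in> K \<and> x \<in> cball (fst i) (snd i) \<and> snd i < d" if x: "x \<in> S" and "0 < d" for x d
  proof -
    obtain e where "e > 0" "ball x e \<subseteq> U"
      using U x by (meson openE subsetD)
    \<comment> \<open>A ball of radius below \<open>e/2\<close> whose closed version contains
      \<open>x\<close> lies inside \<open>ball x e\<close>, hence inside \<open>U\<close>.\<close>
    moreover obtain a r where ar: "0 < r" "r < min d (e/2)" "x \<in> cball a r"
        "emeasure \<mu> (ball a r) \<le> emeasure \<nu> (ball a r)"
      using small[OF x, of "min d (e/2)"] \<open>0 < d\<close> \<open>e > 0\<close> by auto
    moreover have "ball a r \<subseteq> ball x e"
    proof
      fix y assume "y \<in> ball a r"
      then show "y \<in> ball x e"
        using ar dist_triangle[of x y a] by (auto simp: dist_commute)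
    qed
    ultimately show ?thesis
      by (intro exI[of _ "(a,r)"]) (auto simp: K_def)
  qed
  have pos: "\<And>i. i \<in> K \<Longrightarrow> 0 < snd i"
    by (auto simp: K_def)
  obtain C where C: "countable C" "C \<subseteq> K"
     "pairwise (\<lambda>i j. disjnt (cball (fst i) (snd i)) (cball (fst j) (snd j))) C"
     "negligible (S - (\<Union>i \<in> C. cball (fst i) (snd i)))"
    using Vitali_covering_theorem_cballs[OF pos cover] by blast
  define B where "B = (\<lambda>i::'a\<times>real. ball (fst i) (snd i))"
  have disj: "disjoint_family_on B C"
    unfolding disjoint_family_on_def B_def
  proof (intro ballI impI)
    fix i j assume "i \<in> C" "j \<in> C" "i \<noteq> j"
    then have "disjnt (cball (fst i) (snd i)) (cball (fst j) (snd j))"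
      using C(3) by (auto simp: pairwise_def)
    then show "ball (fst i) (snd i) \<inter> ball (fst j) (snd j) = {}"
      using ball_subset_cball[of "fst i" "snd i"] ball_subset_cball[of "fst j" "snd j"]
      unfolding disjnt_def by blast
  qed
  have em: "emeasure M (\<Union>(B ` C)) = (\<integral>\<^sup>+i. emeasure M (B i) \<partial>count_space C)"
    if "sets M = sets borel" for M
    using that disj C(1) by (intro emeasure_UN_countable) (auto simp: B_def)
  have "negligible (\<Union>i\<in>C. sphere (fst i) (snd i))"
    by (auto intro: negligible_sphere \<open>countable C\<close>)
  then have "negligible (S - (\<Union>i \<in> C. cball (fst i) (snd i)) \<union> (\<Union>i \<in> C. sphere (fst i) (snd i)))"
    by (rule negligible_Un [OF C(4)])
  then have "negligible (S - \<Union>(B ` C))"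
    by (rule negligible_subset) (force simp: B_def)
  moreover have "emeasure \<mu> (\<Union>(B ` C)) \<le> emeasure \<nu> (\<Union>(B ` C))"
    unfolding em[OF sets(1)] em[OF sets(2)] using C(2)
    by (intro nn_integral_mono) (auto simp: B_def K_def)
  moreover have "open (\<Union>(B ` C))"
    by (auto simp: B_def)
  moreover have "\<Union>(B ` C) \<subseteq> U"
    using C(2) by (fastforce simp: B_def K_def)
  ultimately show thesis using that by blast
qed

text \<open>Taking \<open>U\<close> close to a measurable hull of \<open>S\<close> gives m \<le>
  \<theta> (m + e) for the outer measure m of \<open>S\<close> and every e > 0. Since m is finite by
  boundedness, m = 0.\<close>

lemma negligible_by_shrinking:
  fixes S :: "'a::euclidean_space set"
  assumes "bounded S" and \<theta>: "0 \<le> \<theta>" "\<theta> < 1"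
    and shrink: "\<And>U. \<lbrakk>open U; S \<subseteq> U\<rbrakk> \<Longrightarrow>
      \<exists>V. V \<in> sets borel \<and> negligible (S - V) \<and> emeasure lborel V \<le> ennreal \<theta> * emeasure lborel U"
  shows "negligible S"
proof -
  \<comment> \<open>Measurability of \<open>S\<close> is not known, so its outer measure is realised
    by a measurable superset.\<close>
  obtain E where E: "E \<in> sets lebesgue" "S \<subseteq> E" and m: "outer_measure_of lebesgue S = emeasure lebesgue E"
    using outer_measure_of_attain[of S lebesgue] by auto
  define m where "m = emeasure lebesgue E"
  obtain c d where "S \<subseteq> cbox c d"
    using bounded_subset_cbox_symmetric[OF \<open>bounded S\<close>] by metis
  then have "m \<le> emeasure lebesgue (cbox c d)"
    unfolding m_def m[symmetric] using outer_measure_of_mono[of S "cbox c d" lebesgue] by simp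
  then have fin: "m < \<infinity>"
    by (rule le_less_trans) (simp add: emeasure_lborel_cbox_eq)
  have le: "m \<le> ennreal \<theta> * (m + ennreal e)" if e: "e > 0" for e
  proof -
    obtain U where U: "open U" "E \<subseteq> U" "U - E \<in> lmeasurable" "emeasure lebesgue (U - E) < ennreal e"
      using sets_lebesgue_outer_open[OF E(1) e] .
    obtain V where V: "V \<in> sets borel" "negligible (S - V)" "emeasure lborel V \<le> ennreal \<theta> * emeasure lborel U"
      using shrink[of U] U E by blast
    have N: "S - V \<in> null_sets lebesgue"
      using V(2) negligible_iff_null_sets by blast
    have "m \<le> emeasure lebesgue (V \<union> (S - V))"
      unfolding m_def m[symmetric]
      using outer_measure_of_mono[of S "V \<union> (S - V)" lebesgue]
        outer_measure_of_eq[of "V \<union> (S - V)" lebesgue] N V(1)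
      by (metis Un_Diff_cancel Un_upper2 null_setsD2 sets.Un sets_completionI_sets sets_lborel)
    also have "\<dots> = emeasure lborel V"
      using N V(1) by (subst emeasure_Un_null_set) auto
    also have "\<dots> \<le> ennreal \<theta> * emeasure lborel U" by fact
    also have "emeasure lborel U = emeasure lebesgue (E \<union> (U - E))"
      using U by (simp add: Un_absorb1)
    also have "\<dots> \<le> m + emeasure lebesgue (U - E)"
      unfolding m_def using E U by (intro emeasure_subadditive) (auto simp: fmeasurableD)
    also have "\<dots> \<le> m + ennreal e"
      using U by (intro add_left_mono) auto
    finally show ?thesis by (simp add: mult_left_mono)
  qed
  obtain k where k: "m = ennreal k" "k \<ge> 0"
    using fin by (cases m) auto
  have "k \<le> \<theta> * (k + e)" if "e > 0" for e
    using le[OF that] \<theta> k that by (simp add: ennreal_mult[symmetric] ennreal_plus[symmetric] del: ennreal_plus)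
  then have "k \<le> \<theta> * k + e" if "e > 0" for e
    using mult_right_mono[of \<theta> 1 e] \<theta> that by (smt (verit, best) distrib_left)
  then have "k \<le> \<theta> * k"
    by (rule field_le_epsilon)
  then have "k = 0"
    using \<theta> k(2) by (smt (verit, best) mult_less_cancel_right2)
  then have "E \<in> null_sets lebesgue"
    using k E by (auto simp: null_sets_def m_def)
  then show ?thesis
    using E(2) negligible_iff_null_sets negligible_subset by blast
qed

text \<open>Arbitrarily small balls around each point of \<open>S\<close> have a hole of comparable
  size, which is open and so misses \<open>closure S\<close> as well. Hence \<open>closure S\<close>
  fills at most a fixed fraction of these balls, and coverings shrink by this factor.\<close>

lemma negligible_porous:
  fixes S :: "'a::euclidean_space set"
  assumes c: "0 < c" "c < 1"
    and porous: "\<And>x d. \<lbrakk>x \<in> S; 0 < d\<rbrakk> \<Longrightarrow>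
      \<exists>r p. 0 < r \<and> r < d \<and> ball p (c * r) \<subseteq> ball x r - S"
  shows "negligible S"
proof -
  \<comment> \<open>Volume scales with the power \<open>DIM('a)\<close> of the radius, so a hole of
    relative radius \<open>c\<close> leaves the fraction \<theta> of the ball.\<close>
  define \<theta> where "\<theta> = 1 - c ^ DIM('a)"
  have \<theta>: "0 \<le> \<theta>" "\<theta> < 1"
    using c by (auto simp: \<theta>_def power_le_one)
  have "negligible (S \<inter> cbox l h)" for l h
  proof (rule negligible_by_shrinking[OF _ \<theta>])
    fix U :: "'a set" assume U: "open U" "S \<inter> cbox l h \<subseteq> U"
    \<comment> \<open>Lebesgue measure restricted to \<open>closure S\<close>, which is Borel
      whatever \<open>S\<close> is.\<close>
    define \<mu> where "\<mu> = density lborel (indicator (closure S))"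
    have em: "emeasure \<mu> X = emeasure lborel (closure S \<inter> X)" if "X \<in> sets borel" for X
      unfolding \<mu>_def using that by (subst emeasure_density) (auto simp: indicator_inter_arith[symmetric])
    have small: "\<exists>a r. 0 < r \<and> r < d \<and> x \<in> cball a r \<and>
        emeasure \<mu> (ball a r) \<le> emeasure (scale_measure (ennreal \<theta>) lborel) (ball a r)"
      if x: "x \<in> S \<inter> cbox l h" and "0 < d" for x d
    proof -
      obtain r p where r: "0 < r" "r < d" "ball p (c * r) \<subseteq> ball x r - S"
        using porous[of x d] x \<open>0 < d\<close> by blast
      have disj: "ball p (c * r) \<inter> closure S = {}"
        using r(3) open_Int_closure_eq_empty[of "ball p (c * r)" S] by auto
      have "emeasure \<mu> (ball x r) = emeasure lborel (closure S \<inter> ball x r)"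
        by (simp add: em)
      also have "\<dots> \<le> emeasure lborel (ball x r - ball p (c * r))"
        using disj by (intro emeasure_mono) auto
      also have "\<dots> = emeasure lborel (ball x r) - emeasure lborel (ball p (c * r))"
        using r c by (subst emeasure_Diff) (auto simp: emeasure_ball)
      also have "\<dots> = ennreal \<theta> * emeasure lborel (ball x r)"
        using r c \<theta>
        by (simp add: emeasure_ball ennreal_minus ennreal_mult[symmetric] \<theta>_def algebra_simps)
      finally show ?thesis
        using r by (intro exI[of _ x] exI[of _ r]) auto
    qed
    obtain V where V: "open V" "V \<subseteq> U" "negligible (S \<inter> cbox l h - V)"
       "emeasure \<mu> V \<le> emeasure (scale_measure (ennreal \<theta>) lborel) V"
      by (rule Vitali_compare_measures[OF _ _ U small]) (auto simp: \<mu>_def)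
    have "emeasure lborel (closure S \<inter> V) \<le> ennreal \<theta> * emeasure lborel U"
    proof -
      have "emeasure lborel (closure S \<inter> V) \<le> ennreal \<theta> * emeasure lborel V"
        using V em[of V] by simp
      also have "\<dots> \<le> ennreal \<theta> * emeasure lborel U"
        using V U by (intro mult_left_mono emeasure_mono) auto
      finally show ?thesis .
    qed
    moreover have "negligible (S \<inter> cbox l h - closure S \<inter> V)"
      using V(3) by (rule negligible_subset) (use closure_subset in auto)
    moreover have "closure S \<inter> V \<in> sets borel"
      using V by auto
    ultimately show "\<exists>V. V \<in> sets borel \<and> negligible (S \<inter> cbox l h - V) \<and>
        emeasure lborel V \<le> ennreal \<theta> * emeasure lborel U"
      by blast
  qed (simp add: bounded_Int)
  then show ?thesis
    using negligible_on_intervals by blast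
qed

section \<open>Differentiability of Lipschitz functions on the line\<close>

lemma emeasure_interval_measure_ball:
  fixes F :: "real \<Rightarrow> real"
  assumes mono: "\<And>x y. x \<le> y \<Longrightarrow> F x \<le> F y" and cont: "continuous_on UNIV F" and "0 < r"
  shows "emeasure (interval_measure F) (ball a r) = ennreal (F (a + r) - F (a - r))"
proof -
  have Icc: "emeasure (interval_measure F) {x..y} = ennreal (F y - F x)" if "x \<le> y" for x y
    using emeasure_interval_measure_Icc[OF that mono cont] by simp
  \<comment> \<open>By continuity of \<open>F\<close> the Stieltjes measure has no atoms, so
    endpoints of intervals do not count.\<close>
  have null: "{x} \<in> null_sets (interval_measure F)" for x
    using Icc[of x x] by (auto simp: null_sets_def)
  have "ball a r = {a - r..a + r} - {a - r} - {a + r}"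
    by (auto simp: dist_real_def)
  then show ?thesis
    using \<open>0 < r\<close> by (simp add: emeasure_Diff_null_set null Icc)
qed

text \<open>The lower and upper limits are finite and, in the absence of a limit, distinct, so two
  rationals fit strictly between them. Rationality will leave only countably many pairs to consider;
  the lower bound 1 makes \<open>a\<close> positive.\<close>

lemma frequently_oscillates:
  fixes q :: "'a \<Rightarrow> real"
  assumes "F \<noteq> bot" and bd: "\<forall>\<^sub>F h in F. 1 \<le> q h" "\<forall>\<^sub>F h in F. q h \<le> B"
    and nolim: "\<And>l. \<not> (q \<longlongrightarrow> l) F"
  obtains a b where "a \<in> \<rat>" "b \<in> \<rat>" "0 < a" "a < b"
    "\<exists>\<^sub>F h in F. q h < a" "\<exists>\<^sub>F h in F. b < q h"
proof -
  define l where "l = Liminf F (\<lambda>h. ereal (q h))"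
  define m where "m = Limsup F (\<lambda>h. ereal (q h))"
  have lm: "l \<le> m"
    unfolding l_def m_def using \<open>F \<noteq> bot\<close> by (intro Liminf_le_Limsup) auto
  have l1: "1 \<le> l"
    unfolding l_def using bd(1) by (intro Liminf_bounded) auto
  have mB: "m \<le> B"
    unfolding m_def using bd(2) by (intro Limsup_bounded) auto
  have "l \<noteq> m"
  proof
    assume "l = m"
    moreover obtain l' where "l = ereal l'"
      using l1 lm mB by (cases l) auto
    ultimately have "((\<lambda>h. ereal (q h)) \<longlongrightarrow> ereal l') F"
      using \<open>F \<noteq> bot\<close> by (intro Liminf_eq_Limsup) (auto simp: l_def m_def)
    then show False using nolim by simp
  qed
  with lm have "l < m" by simp
  then obtain r :: rat where r: "l < ereal (real_of_rat r)" "ereal (real_of_rat r) < m"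
    using ereal_dense3 by blast
  then obtain s :: rat where s: "ereal (real_of_rat r) < ereal (real_of_rat s)" "ereal (real_of_rat s) < m"
    using ereal_dense3 by blast
  show thesis
  proof
    show "0 < real_of_rat r"
      using l1 r(1) by (cases l) (auto simp del: zero_less_of_rat_iff)
    show "real_of_rat r < real_of_rat s" using s(1) by simp
    show "\<exists>\<^sub>F h in F. q h < real_of_rat r"
    proof (rule ccontr)
      assume "\<not> ?thesis"
      then have "\<forall>\<^sub>F h in F. ereal (real_of_rat r) \<le> ereal (q h)"
        by (simp add: not_frequently not_less)
      then have "ereal (real_of_rat r) \<le> l"
        unfolding l_def by (rule Liminf_bounded)
      then show False using r(1) by simp
    qed
    show "\<exists>\<^sub>F h in F. real_of_rat s < q h"
    proof (rule ccontr)
      assume "\<not> ?thesis"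
      then have "\<forall>\<^sub>F h in F. ereal (q h) \<le> ereal (real_of_rat s)"
        by (simp add: not_frequently not_less)
      then have "m \<le> ereal (real_of_rat s)"
        unfolding m_def by (rule Limsup_bounded)
      then show False using s(2) by simp
    qed
  qed auto
qed

lemma frequently_at_0_obtain:
  fixes P :: "real \<Rightarrow> bool"
  assumes "\<exists>\<^sub>F h in at 0. P h" "0 < d"
  obtains h where "h \<noteq> 0" "\<bar>h\<bar> < d" "P h"
proof -
  have "\<forall>\<^sub>F h in at 0. h \<noteq> 0 \<and> \<bar>h\<bar> < (d::real)"
    using \<open>0 < d\<close> by (auto simp: eventually_at dist_real_def intro!: exI[of _ d])
  then have "\<exists>\<^sub>F h in at 0. P h \<and> h \<noteq> 0 \<and> \<bar>h\<bar> < d"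
    using assms(1) frequently_eventually_frequently by blast
  then show thesis
    using that frequently_ex by blast
qed

text \<open>The Stieltjes measure of \<open>g\<close> is at most \<open>a\<close> times Lebesgue measure on a family of intervals
  covering \<open>S\<close> and at least \<open>b\<close> times Lebesgue measure on a finer one, so coverings of \<open>S\<close> can be
  shrunk by the factor \<open>a / b\<close>.\<close>
lemma negligible_oscillating_difference_quotient:
  fixes g :: "real \<Rightarrow> real"
  assumes mono: "\<And>x y. x \<le> y \<Longrightarrow> g x \<le> g y" and cont: "continuous_on UNIV g"
    and ab: "0 < a" "a < b"
    and S: "\<And>x. x \<in> S \<Longrightarrow> (\<exists>\<^sub>F h in at 0. (g (x + h) - g x) / h < a)"
           "\<And>x. x \<in> S \<Longrightarrow> (\<exists>\<^sub>F h in at 0. b < (g (x + h) - g x) / h)"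
  shows "negligible S"
proof -
  let ?\<mu> = "interval_measure g"
  \<comment> \<open>The ball is the open interval between \<open>x\<close> and \<open>x + h\<close>
    for either sign of \<open>h\<close>; the factor |h| turns the difference quotient into the
    increment of \<open>g\<close> across it.\<close>
  have mu: "emeasure ?\<mu> (ball (x + h/2) (\<bar>h\<bar>/2)) = ennreal (\<bar>h\<bar> * ((g (x + h) - g x) / h))"
    and la: "emeasure lborel (ball (x + h/2) (\<bar>h\<bar>/2)) = ennreal \<bar>h\<bar>" if "h \<noteq> 0" for x h
  proof -
    have "g (x + h/2 + \<bar>h\<bar>/2) - g (x + h/2 - \<bar>h\<bar>/2) = \<bar>h\<bar> * ((g (x + h) - g x) / h)"
      using that by (cases "0 < h") (simp_all add: add.assoc)
    then show "emeasure ?\<mu> (ball (x + h/2) (\<bar>h\<bar>/2)) = ennreal (\<bar>h\<bar> * ((g (x + h) - g x) / h))"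
      using that by (subst emeasure_interval_measure_ball[OF mono cont]) auto
    have "ball (x + h/2) (\<bar>h\<bar>/2) = {min x (x+h)<..<max x (x+h)}"
      by (auto simp: dist_real_def abs_if field_simps split: if_splits)
    then show "emeasure lborel (ball (x + h/2) (\<bar>h\<bar>/2)) = ennreal \<bar>h\<bar>"
      by (auto simp: abs_if min_def max_def)
  qed
  have sb: "sets ?\<mu> = sets borel" "sets (scale_measure c lborel) = sets (borel :: real measure)" for c
    by simp_all
  have mem: "x \<in> cball (x + h/2) (\<bar>h\<bar>/2)" for x h :: real
    by (simp add: dist_real_def)
  have "negligible (S \<inter> cbox l k)" for l k
  proof (rule negligible_by_shrinking[of _ "a / b"])
    let ?S = "S \<inter> cbox l k"
    fix U :: "real set" assume U: "open U" "?S \<subseteq> U"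
    have small1: "\<exists>c r. 0 < r \<and> r < d \<and> x \<in> cball c r \<and>
        emeasure ?\<mu> (ball c r) \<le> emeasure (scale_measure (ennreal a) lborel) (ball c r)"
      if x: "x \<in> ?S" and "0 < d" for x d
    proof -
      obtain h where h: "h \<noteq> 0" "\<bar>h\<bar> < d" "(g (x + h) - g x) / h < a"
        using frequently_at_0_obtain[OF S(1) \<open>0 < d\<close>] x by auto
      have "\<bar>h\<bar> * ((g (x + h) - g x) / h) \<le> \<bar>h\<bar> * a"
        using h by (intro mult_left_mono) auto
      then show ?thesis
        using h ab mem[of x h]
        by (intro exI[of _ "x + h/2"] exI[of _ "\<bar>h\<bar>/2"])
           (auto simp: mu la ennreal_mult[symmetric] mult.commute simp del: times_divide_eq_right)
    qed
    obtain V where V: "open V" "V \<subseteq> U" "negligible (?S - V)"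
       "emeasure ?\<mu> V \<le> emeasure (scale_measure (ennreal a) lborel) V"
      using Vitali_compare_measures[OF sb(1) sb(2) U small1] by blast
    \<comment> \<open>The second cover lives inside \<open>V\<close>, so the two comparisons chain
      to b |W| \<le> \<mu>(W) \<le> \<mu>(V) \<le> a |V| with \<mu> the Stieltjes measure.\<close>
    have small2: "\<exists>c r. 0 < r \<and> r < d \<and> x \<in> cball c r \<and>
        emeasure (scale_measure (ennreal b) lborel) (ball c r) \<le> emeasure ?\<mu> (ball c r)"
      if x: "x \<in> ?S \<inter> V" and "0 < d" for x d
    proof -
      obtain h where h: "h \<noteq> 0" "\<bar>h\<bar> < d" "b < (g (x + h) - g x) / h"
        using frequently_at_0_obtain[OF S(2) \<open>0 < d\<close>] x by auto
      have "\<bar>h\<bar> * b \<le> \<bar>h\<bar> * ((g (x + h) - g x) / h)"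
        using h by (intro mult_left_mono) auto
      then show ?thesis
        using h ab mem[of x h]
        by (intro exI[of _ "x + h/2"] exI[of _ "\<bar>h\<bar>/2"])
           (auto simp: mu la ennreal_mult[symmetric] mult.commute intro!: ennreal_leI
             simp del: times_divide_eq_right)
    qed
    obtain W where W: "open W" "W \<subseteq> V" "negligible (?S \<inter> V - W)"
       "emeasure (scale_measure (ennreal b) lborel) W \<le> emeasure ?\<mu> W"
      using Vitali_compare_measures[OF sb(2) sb(1) V(1) Int_lower2 small2] by blast
    have "ennreal b * emeasure lborel W \<le> emeasure ?\<mu> W"
      using W(4) by simp
    also have "\<dots> \<le> emeasure ?\<mu> V"
      using V W by (intro emeasure_mono) auto
    also have "\<dots> \<le> ennreal a * emeasure lborel V"
      using V(4) by simp
    also have "\<dots> \<le> ennreal a * emeasure lborel U"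
      using V U by (intro mult_left_mono emeasure_mono) auto
    finally have *: "ennreal b * emeasure lborel W \<le> ennreal a * emeasure lborel U" .
    have "emeasure lborel W = ennreal (1 / b) * (ennreal b * emeasure lborel W)"
      using ab by (simp add: mult.assoc[symmetric] ennreal_mult[symmetric])
    also have "\<dots> \<le> ennreal (1 / b) * (ennreal a * emeasure lborel U)"
      using * by (intro mult_left_mono) auto
    also have "\<dots> = ennreal (a / b) * emeasure lborel U"
      using ab by (simp add: mult.assoc[symmetric] ennreal_mult[symmetric])
    finally have "emeasure lborel W \<le> ennreal (a / b) * emeasure lborel U" .
    moreover have "negligible (?S - W)"
      using negligible_Un[OF V(3) W(3)] by (rule negligible_subset) auto
    ultimately show "\<exists>V. V \<in> sets borel \<and> negligible (?S - V) \<and>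
        emeasure lborel V \<le> ennreal (a / b) * emeasure lborel U"
      using W(1) by (intro exI[of _ W]) auto
  qed (use ab in \<open>auto simp: bounded_Int\<close>)
  then show ?thesis
    using negligible_on_intervals by blast
qed

text \<open>Where the derivative fails to exist, the difference quotients oscillate across some
  rational gap \<open>a < b\<close>; there are countably many gaps, and each contributes a null
  set.\<close>

lemma lipschitz_real_differentiable_ae:
  fixes u :: "real \<Rightarrow> real"
  assumes L: "L-lipschitz_on UNIV u"
  shows "negligible {x. \<not> u differentiable (at x)}"
proof -
  \<comment> \<open>The added linear term leaves differentiability unchanged and confines the
    difference quotients to [1, 2 L + 1], so \<open>g\<close> is increasing.\<close>
  define g where "g = (\<lambda>x. u x + (L + 1) * x)"
  have g_incr: "y - x \<le> g y - g x" "g y - g x \<le> (2 * L + 1) * (y - x)" if "x \<le> y" for x y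
    using lipschitz_onD[OF L, of x y] that
    by (auto simp: g_def dist_real_def algebra_simps)
  have mono: "g x \<le> g y" if "x \<le> y" for x y
    using g_incr(1)[OF that] that by simp
  have cont: "continuous_on UNIV g"
    unfolding g_def using lipschitz_on_continuous_on[OF L] by (intro continuous_intros)
  define q where "q = (\<lambda>x h. (g (x + h) - g x) / h)"
  define S where "S = (\<lambda>(a,b). {x. (\<exists>\<^sub>F h in at 0. q x h < a) \<and> (\<exists>\<^sub>F h in at 0. b < q x h)})"
  define P where "P = {(a::real,b::real). a \<in> \<rat> \<and> b \<in> \<rat> \<and> 0 < a \<and> a < b}"
  have sub: "{x. \<not> u differentiable (at x)} \<subseteq> (\<Union>p\<in>P. S p)"
  proof
    fix x assume "x \<in> {x. \<not> u differentiable (at x)}"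
    then have nd: "\<not> u differentiable (at x)" by simp
    have nolim: "\<not> (q x \<longlongrightarrow> l) (at 0)" for l
    proof
      assume "(q x \<longlongrightarrow> l) (at 0)"
      then have "(g has_real_derivative l) (at x)"
        by (simp add: DERIV_def q_def)
      then have "((\<lambda>y. g y - (L + 1) * y) has_real_derivative l - (L + 1)) (at x)"
        by (auto intro!: derivative_eq_intros)
      then have "u differentiable (at x)"
        by (auto simp: g_def real_differentiable_def)
      then show False using nd by simp
    qed
    have "1 \<le> q x h" "q x h \<le> 2 * L + 1" if "h \<noteq> 0" for h
      using g_incr[of x "x + h"] g_incr[of "x + h" x] that
      by (auto simp: q_def divide_simps mult.commute split: if_splits)
    then have ev: "\<forall>\<^sub>F h in at 0. 1 \<le> q x h" "\<forall>\<^sub>F h in at 0. q x h \<le> 2 * L + 1"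
      by (auto simp: eventually_at_filter)
    obtain a b where "a \<in> \<rat>" "b \<in> \<rat>" "0 < a" "a < b"
      "\<exists>\<^sub>F h in at 0. q x h < a" "\<exists>\<^sub>F h in at 0. b < q x h"
      by (rule frequently_oscillates[OF _ ev nolim]) auto
    then show "x \<in> (\<Union>p\<in>P. S p)"
      by (auto simp: S_def P_def)
  qed
  have "countable P"
    by (rule countable_subset[of _ "\<rat> \<times> \<rat>"]) (auto simp: P_def intro: countable_rat)
  moreover have "negligible (S p)" if pP: "p \<in> P" for p
  proof -
    obtain a b where p: "p = (a,b)" "0 < a" "a < b"
      using pP by (auto simp: P_def)
    show ?thesis
      unfolding p(1)
      by (rule negligible_oscillating_difference_quotient[OF mono cont p(2,3)]) (auto simp: S_def q_def)
  qed
  ultimately have "negligible (\<Union>p\<in>P. S p)"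
    by (intro negligible_countable_Union) auto
  then show ?thesis
    using sub negligible_subset by blast
qed

section \<open>Rademacher's theorem\<close>

text \<open>Two affine approximations at the same point have nearby slopes, as testing along the
  difference of the slopes shows. The slopes for tolerances tending to 0 thus form a Cauchy
  sequence, whose limit is the derivative.\<close>

lemma differentiable_if_approximable:
  fixes u :: "'a::euclidean_space \<Rightarrow> real"
  assumes approx: "\<And>e. 0 < e \<Longrightarrow>
    \<exists>q. \<exists>d>0. \<forall>y. norm (y - x) < d \<longrightarrow> \<bar>u y - u x - q \<bullet> (y - x)\<bar> \<le> e * norm (y - x)"
  shows "u differentiable (at x)"
proof -
  define e where "e = (\<lambda>k::nat. 1 / Suc k)"
  have e_pos: "0 < e k" for k by (simp add: e_def)
  obtain q where q: "\<And>k. \<exists>d>0. \<forall>y. norm (y - x) < d \<longrightarrow> \<bar>u y - u x - q k \<bullet> (y - x)\<bar> \<le> e k * norm (y - x)"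
    using approx[OF e_pos] by metis
  have close: "norm (q j - q k) \<le> e j + e k" for j k
  proof (cases "q j = q k")
    case False
    obtain d1 where d1: "d1 > 0" "\<And>y. norm (y - x) < d1 \<Longrightarrow> \<bar>u y - u x - q j \<bullet> (y - x)\<bar> \<le> e j * norm (y - x)"
      using q[of j] by blast
    obtain d2 where d2: "d2 > 0" "\<And>y. norm (y - x) < d2 \<Longrightarrow> \<bar>u y - u x - q k \<bullet> (y - x)\<bar> \<le> e k * norm (y - x)"
      using q[of k] by blast
    \<comment> \<open>In direction \<open>w\<close> the two linear forms differ most; the
      displacement \<open>s *\<^sub>R w\<close> has length \<open>min d1 d2 / 2\<close>, within both
      neighbourhoods.\<close>
    define w where "w = q j - q k"
    define s where "s = min d1 d2 / (2 * norm w)"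
    have w: "norm w > 0" using False by (simp add: w_def)
    have s: "s > 0" using d1 d2 w by (simp add: s_def)
    have nv: "norm (s *\<^sub>R w) < d1" "norm (s *\<^sub>R w) < d2"
      using d1(1) d2(1) w s by (auto simp: s_def)
    have "\<bar>w \<bullet> (s *\<^sub>R w)\<bar> \<le> (e j + e k) * norm (s *\<^sub>R w)"
      using d1(2)[of "x + s *\<^sub>R w"] d2(2)[of "x + s *\<^sub>R w"] nv
      unfolding w_def by (simp add: inner_diff_left algebra_simps)
    then have "s * (norm w * norm w) \<le> s * ((e j + e k) * norm w)"
      using s by (simp add: power2_norm_eq_inner[symmetric] power2_eq_square abs_mult algebra_simps)
    then show ?thesis
      using s w by (simp add: w_def)
  qed (use e_pos in \<open>simp add: add_nonneg_nonneg less_imp_le\<close>)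
  have e0: "e \<longlonglongrightarrow> 0"
    unfolding e_def using LIMSEQ_inverse_real_of_nat by (simp add: divide_inverse)
  have "Cauchy q"
  proof (rule metric_CauchyI)
    fix r :: real assume "r > 0"
    then obtain M where "\<And>n. n \<ge> M \<Longrightarrow> e n < r / 2"
      using order_tendstoD(2)[OF e0, of "r/2"] by (auto simp: eventually_sequentially)
    then show "\<exists>M. \<forall>m\<ge>M. \<forall>n\<ge>M. dist (q m) (q n) < r"
      using close by (intro exI[of _ M]) (auto simp: dist_norm, smt (verit, best) field_sum_of_halves)
  qed
  then obtain l where l: "q \<longlonglongrightarrow> l"
    using Cauchy_convergent convergent_def by blast
  have "(u has_derivative (\<lambda>v. l \<bullet> v)) (at x)"
    unfolding has_derivative_at_alt
  proof (intro conjI allI impI)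
    show "bounded_linear (\<lambda>v. l \<bullet> v)" by (rule bounded_linear_inner_right)
    fix r :: real assume r: "0 < r"
    have "(\<lambda>k. e k + norm (q k - l)) \<longlonglongrightarrow> 0 + norm (l - l)"
      by (intro tendsto_intros e0 l)
    then have "\<forall>\<^sub>F k in sequentially. e k + norm (q k - l) < r"
      using r by (intro order_tendstoD(2)) auto
    then obtain k where k: "e k + norm (q k - l) < r"
      using eventually_happens trivial_limit_sequentially by blast
    obtain d where d: "d > 0" "\<And>y. norm (y - x) < d \<Longrightarrow> \<bar>u y - u x - q k \<bullet> (y - x)\<bar> \<le> e k * norm (y - x)"
      using q[of k] by blast
    have "norm (u y - u x - l \<bullet> (y - x)) \<le> r * norm (y - x)" if "norm (y - x) < d" for y
    proof -
      have "\<bar>(q k - l) \<bullet> (y - x)\<bar> \<le> norm (q k - l) * norm (y - x)"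
        by (rule Cauchy_Schwarz_ineq2)
      then have "\<bar>u y - u x - l \<bullet> (y - x)\<bar> \<le> (e k + norm (q k - l)) * norm (y - x)"
        using d(2)[OF that] by (simp add: inner_diff_left distrib_right)
      also have "\<dots> \<le> r * norm (y - x)"
        using k by (intro mult_right_mono) auto
      finally show ?thesis by simp
    qed
    then show "\<exists>d>0. \<forall>y. norm (y - x) < d \<longrightarrow> norm (u y - u x - l \<bullet> (y - x)) \<le> r * norm (y - x)"
      using d(1) by blast
  qed
  then show ?thesis
    unfolding differentiable_def by blast
qed

section \<open>Differentiability along lines\<close>

text \<open>Moving the base point along the line carries the parameter \<open>s\<close> to 0. This
  lets the one-dimensional theorem speak about the set of points \<open>x\<close> that are bad at
  parameter 0.\<close>

lemma differentiable_along_line_iff: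
  fixes u :: "'a::real_normed_vector \<Rightarrow> real"
  shows "(\<lambda>t. u (x + t *\<^sub>R b)) differentiable (at s) \<longleftrightarrow>
    (\<lambda>t. u (x + s *\<^sub>R b + t *\<^sub>R b)) differentiable (at 0)"
proof -
  have "(\<lambda>t. u (x + t *\<^sub>R b)) differentiable (at s) \<longleftrightarrow>
      (\<lambda>t. u (x + (s + t) *\<^sub>R b)) differentiable (at 0)"
    by (simp add: real_differentiable_def DERIV_def)
  then show ?thesis
    by (simp add: scaleR_left_distrib add.assoc)
qed

lemma differentiable_along_lineE:
  fixes u :: "'a::real_normed_vector \<Rightarrow> real"
  assumes "(\<lambda>t. u (x + t *\<^sub>R b)) differentiable (at 0)"
  obtains l where "\<And>e. 0 < e \<Longrightarrow> \<exists>d>0. \<forall>h. \<bar>h\<bar> < d \<longrightarrow> \<bar>u (x + h *\<^sub>R b) - u x - h * l\<bar> \<le> e * \<bar>h\<bar>"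
proof -
  obtain l where "((\<lambda>t. u (x + t *\<^sub>R b)) has_derivative (\<lambda>h. h * l)) (at 0)"
    using assms by (metis real_differentiable_def has_field_derivative_def mult_commute_abs)
  then show thesis
    unfolding has_derivative_at_alt by (intro that[of l]) auto
qed

text \<open>Supplies the measurability for Fubini's theorem. Differentiability means that for each
  \<open>k\<close> some rational slope \<open>q\<close> is accurate to \<open>1 / Suc k\<close> on
  some scale \<open>1 / Suc m\<close>; for fixed parameters this is an intersection of closed
  conditions on \<open>x\<close>.\<close>

lemma directional_differentiability_borel:
  fixes u :: "'a::euclidean_space \<Rightarrow> real"
  assumes cont: "continuous_on UNIV u"
  shows "{x. (\<lambda>t. u (x + t *\<^sub>R b)) differentiable (at 0)} \<in> sets borel"
proof -
  define A where "A = (\<lambda>(k::nat) (q::real) (m::nat).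
     {x. \<forall>h. \<bar>h\<bar> < 1 / Suc m \<longrightarrow> \<bar>u (x + h *\<^sub>R b) - u x - h * q\<bar> \<le> 1 / Suc k * \<bar>h\<bar>})"
  have "closed (A k q m)" for k q m
  proof -
    have "A k q m = (\<Inter>h\<in>{h. \<bar>h\<bar> < 1 / Suc m}. {x. \<bar>u (x + h *\<^sub>R b) - u x - h * q\<bar> \<le> 1 / Suc k * \<bar>h\<bar>})"
      by (auto simp: A_def)
    also have "closed \<dots>"
      by (intro closed_INT ballI closed_Collect_le continuous_intros
          continuous_on_compose2[OF cont]) auto
    finally show ?thesis .
  qed
  then have "(\<Union>q\<in>\<rat>. \<Union>m. A k q m) \<in> sets borel" for k
    by (intro sets.countable_UN'[OF countable_rat] sets.countable_UN) auto
  then have "(\<Inter>k. \<Union>q\<in>\<rat>. \<Union>m. A k q m) \<in> sets borel"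
    by (intro sets.countable_INT) auto
  also have "(\<Inter>k. \<Union>q\<in>\<rat>. \<Union>m. A k q m) = {x. (\<lambda>t. u (x + t *\<^sub>R b)) differentiable (at 0)}"
  proof (intro set_eqI iffI)
    fix x assume x: "x \<in> (\<Inter>k. \<Union>q\<in>\<rat>. \<Union>m. A k q m)"
    show "x \<in> {x. (\<lambda>t. u (x + t *\<^sub>R b)) differentiable (at 0)}"
    proof (rule CollectI, rule differentiable_if_approximable)
      fix e :: real assume "0 < e"
      then obtain k :: nat where k: "1 / Suc k < e"
        using nat_approx_posE by blast
      obtain q m where x: "x \<in> A k q m" using x by blast
      have "\<bar>u (x + h *\<^sub>R b) - u x - h * q\<bar> \<le> e * \<bar>h\<bar>" if "\<bar>h\<bar> < 1 / Suc m" for h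
      proof -
        have "\<bar>u (x + h *\<^sub>R b) - u x - h * q\<bar> \<le> 1 / Suc k * \<bar>h\<bar>"
          using x that by (auto simp: A_def)
        also have "\<dots> \<le> e * \<bar>h\<bar>" using k by (intro mult_right_mono) auto
        finally show ?thesis .
      qed
      then show "\<exists>q. \<exists>d>0. \<forall>y. norm (y - 0) < d \<longrightarrow>
          \<bar>u (x + y *\<^sub>R b) - u (x + 0 *\<^sub>R b) - q \<bullet> (y - 0)\<bar> \<le> e * norm (y - 0)"
        by (intro exI[of _ q] exI[of _ "1 / Suc m"]) (auto simp: mult.commute)
    qed
  next
    fix x assume "x \<in> {x. (\<lambda>t. u (x + t *\<^sub>R b)) differentiable (at 0)}"
    then obtain l where l: "\<And>e. 0 < e \<Longrightarrow> \<exists>d>0. \<forall>h. \<bar>h\<bar> < d \<longrightarrow> \<bar>u (x + h *\<^sub>R b) - u x - h * l\<bar> \<le> e * \<bar>h\<bar>"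
      using differentiable_along_lineE by blast
    have "\<exists>q\<in>\<rat>. \<exists>m. x \<in> A k q m" for k
    proof -
      define e where "e = 1 / real (Suc k)"
      have e: "e > 0" by (simp add: e_def)
      \<comment> \<open>Half of \<open>e\<close> pays for the error at slope \<open>l\<close>, the
        other half for replacing \<open>l\<close> by a rational \<open>q\<close>.\<close>
      obtain d where d: "d > 0" "\<And>h. \<bar>h\<bar> < d \<Longrightarrow> \<bar>u (x + h *\<^sub>R b) - u x - h * l\<bar> \<le> e / 2 * \<bar>h\<bar>"
        using l[of "e/2"] e by auto
      obtain q where q: "q \<in> \<rat>" "l < q" "q < l + e/2"
        using Rats_dense_in_real[of l "l + e/2"] e by auto
      obtain m :: nat where m: "1 / Suc m < d"
        using nat_approx_posE[OF d(1)] by blast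
      have "\<bar>u (x + h *\<^sub>R b) - u x - h * q\<bar> \<le> e * \<bar>h\<bar>" if "\<bar>h\<bar> < 1 / Suc m" for h
      proof -
        have "\<bar>h * l - h * q\<bar> = \<bar>l - q\<bar> * \<bar>h\<bar>"
          by (simp add: abs_mult[symmetric] algebra_simps)
        also have "\<dots> \<le> e/2 * \<bar>h\<bar>" using q by (intro mult_right_mono) auto
        finally show ?thesis
          using d(2)[of h] that m by linarith
      qed
      then show ?thesis using q(1) by (auto simp: A_def e_def)
    qed
    then show "x \<in> (\<Inter>k. \<Union>q\<in>\<rat>. \<Union>m. A k q m)" by simp
  qed
  finally show ?thesis .
qed

text \<open>Every line in direction \<open>b\<close> meets the exceptional set in a null set of
  parameters. Integrating the indicator of this set at \<open>x + t *\<^sub>R b\<close> over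
  \<open>x\<close> and \<open>t\<close> in both orders gives 0 one way and, by translation
  invariance, infinity times the measure of the set the other way.\<close>

lemma lipschitz_directionally_differentiable_ae:
  fixes u :: "'a::euclidean_space \<Rightarrow> real"
  assumes L: "L-lipschitz_on UNIV u"
  shows "negligible {x. \<not> (\<lambda>t. u (x + t *\<^sub>R b)) differentiable (at 0)}" (is "negligible ?N")
proof -
  have "{x. (\<lambda>t. u (x + t *\<^sub>R b)) differentiable (at 0)} \<in> sets borel"
    by (rule directional_differentiability_borel[OF lipschitz_on_continuous_on[OF L]])
  then have "- {x. (\<lambda>t. u (x + t *\<^sub>R b)) differentiable (at 0)} \<in> sets borel"
    by (metis borel_comp)
  then have N[measurable]: "?N \<in> sets borel"
    by (simp add: Collect_neg_eq[symmetric])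
  have inner0: "(\<integral>\<^sup>+t. indicator ?N (x + t *\<^sub>R b) \<partial>lborel) = 0" for x
  proof -
    have "(L * norm b)-lipschitz_on UNIV (\<lambda>t. u (x + t *\<^sub>R b))"
    proof (rule lipschitz_onI)
      fix s t :: real
      have "dist (u (x + s *\<^sub>R b)) (u (x + t *\<^sub>R b)) \<le> L * dist (x + s *\<^sub>R b) (x + t *\<^sub>R b)"
        by (rule lipschitz_onD[OF L]) auto
      also have "\<dots> = L * norm b * dist s t"
        by (simp add: dist_norm scaleR_diff_left[symmetric])
      finally show "dist (u (x + s *\<^sub>R b)) (u (x + t *\<^sub>R b)) \<le> L * norm b * dist s t" .
    qed (use lipschitz_on_nonneg[OF L] in auto)
    then have "negligible {t. \<not> (\<lambda>t. u (x + t *\<^sub>R b)) differentiable (at t)}"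
      by (rule lipschitz_real_differentiable_ae)
    then have "negligible {t. x + t *\<^sub>R b \<in> ?N}"
      by (simp only: mem_Collect_eq differentiable_along_line_iff[of u x b, symmetric])
    moreover have "{t. x + t *\<^sub>R b \<in> ?N} \<in> sets borel"
      using measurable_sets[of "\<lambda>t. x + t *\<^sub>R b" borel borel ?N] N by (simp add: vimage_def)
    ultimately have "emeasure lborel {t. x + t *\<^sub>R b \<in> ?N} = 0"
      by (simp add: negligible_iff_emeasure0)
    moreover have "(\<integral>\<^sup>+t. indicator ?N (x + t *\<^sub>R b) \<partial>lborel) = (\<integral>\<^sup>+t. indicator {t. x + t *\<^sub>R b \<in> ?N} t \<partial>lborel)"
      by (intro nn_integral_cong) (auto simp: indicator_def)
    ultimately show ?thesis
      using \<open>{t. x + t *\<^sub>R b \<in> ?N} \<in> sets borel\<close> by (simp add: nn_integral_indicator)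
  qed
  have trans: "(\<integral>\<^sup>+x. indicator ?N (x + t *\<^sub>R b) \<partial>lborel) = emeasure lborel ?N" for t
  proof -
    have "emeasure lborel ?N = (\<integral>\<^sup>+x. indicator ?N x \<partial>distr lborel borel ((+) (t *\<^sub>R b)))"
      by (simp add: lborel_distr_plus)
    also have "\<dots> = (\<integral>\<^sup>+x. indicator ?N (t *\<^sub>R b + x) \<partial>lborel)"
      by (subst nn_integral_distr) auto
    finally show ?thesis by (simp add: add.commute)
  qed
  have "emeasure lborel ?N * \<infinity> = (\<integral>\<^sup>+(t::real). emeasure lborel ?N \<partial>lborel)"
    by (simp add: emeasure_lborel_UNIV)
  also have "\<dots> = (\<integral>\<^sup>+t. (\<integral>\<^sup>+x. indicator ?N (x + t *\<^sub>R b) \<partial>lborel) \<partial>lborel)"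
    by (simp add: trans)
  also have "\<dots> = (\<integral>\<^sup>+x. (\<integral>\<^sup>+t. indicator ?N (x + t *\<^sub>R b) \<partial>lborel) \<partial>lborel)"
    by (rule lborel_pair.Fubini') measurable
  also have "\<dots> = 0" by (simp add: inner0)
  finally have "emeasure lborel ?N = 0"
    by (auto simp: ennreal_mult_eq_top_iff)
  then show ?thesis
    using N by (simp add: negligible_iff_emeasure0)
qed

section \<open>From partial to total differentiability\<close>

text \<open>\<open>y\<close> is reached from \<open>x\<close> by changing one coordinate at a time.
  The corners of this path may lie outside \<open>A\<close>, but each has a point of
  \<open>A\<close> within \<open>e * r\<close>, whose estimate is transferred by the Lipschitz bound
  at a cost of \<open>2 * (L * (e * r))\<close>. The constant arises by summing over
  \<open>DIM('a)\<close> steps.\<close>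

lemma approximation_near_nonporous_point:
  fixes u :: "'a::euclidean_space \<Rightarrow> real" and L :: real
  assumes L: "L-lipschitz_on UNIV u" and e: "0 < e" "e \<le> 1/2" and "0 < d" "0 < \<delta>"
    and A: "\<And>z b h. \<lbrakk>z \<in> A; b \<in> Basis; \<bar>h\<bar> < \<delta>\<rbrakk> \<Longrightarrow> \<bar>u (z + h *\<^sub>R b) - u z - h * (q \<bullet> b)\<bar> \<le> e * \<bar>h\<bar>"
    and dense: "\<And>r p. \<lbrakk>0 < r; r < d; ball p (e * r) \<subseteq> ball x r\<rbrakk> \<Longrightarrow> ball p (e * r) \<inter> A \<noteq> {}"
    and y: "norm (y - x) < min \<delta> (d / (2 * DIM('a)))"
  shows "\<bar>u y - u x - q \<bullet> (y - x)\<bar> \<le> real DIM('a) * (1 + 4 * real DIM('a) * L) * e * norm (y - x)"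
proof (cases "y = x")
  case False
  define v where "v = y - x"
  define s where "s = norm v"
  \<comment> \<open>The corners stay within \<open>r / 2\<close> of \<open>x\<close>; with
    \<open>e \<le> 1/2\<close> the ball of radius \<open>e * r\<close> about a corner then fits into
    \<open>ball x r\<close>.\<close>
  define r where "r = 2 * real DIM('a) * s"
  have s: "0 < s" "s < \<delta>" using False y by (auto simp: s_def v_def)
  have r: "0 < r" "r < d" using y s by (auto simp: r_def s_def v_def field_simps)
  have L0: "0 \<le> L" using lipschitz_on_nonneg[OF L] .
  have vb: "\<bar>v \<bullet> b\<bar> \<le> s" if "b \<in> Basis" for b
    using Basis_le_norm[OF that] by (simp add: s_def)
  \<comment> \<open>Induction over the set of coordinates already changed; \<open>p\<close> is the
    current corner and \<open>h\<close> the next displacement.\<close>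
  have "\<bar>u (x + (\<Sum>b\<in>B. (v \<bullet> b) *\<^sub>R b)) - u x - (\<Sum>b\<in>B. (v \<bullet> b) * (q \<bullet> b))\<bar>
      \<le> card B * ((1 + 4 * real DIM('a) * L) * e * s)" if "finite B" "B \<subseteq> Basis" for B
    using that
  proof (induction B rule: finite_induct)
    case (insert b B)
    define p where "p = x + (\<Sum>b\<in>B. (v \<bullet> b) *\<^sub>R b)"
    define h where "h = v \<bullet> b"
    have h: "\<bar>h\<bar> \<le> s" using vb insert by (auto simp: h_def)
    have "norm (\<Sum>b\<in>B. (v \<bullet> b) *\<^sub>R b) \<le> (\<Sum>b\<in>B. \<bar>v \<bullet> b\<bar>)"
      using insert.prems by (intro sum_norm_le) auto
    also have "\<dots> \<le> real (card B) * s"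
      using vb insert.prems by (intro sum_bounded_above) auto
    also have "\<dots> \<le> real DIM('a) * s"
      using s insert.prems insert.hyps by (intro mult_right_mono) (auto intro!: card_mono)
    finally have px: "dist x p \<le> real DIM('a) * s"
      by (simp add: p_def dist_norm)
    have "e * r \<le> 1/2 * r" using e r by (intro mult_right_mono) auto
    moreover have "dist x p \<le> 1/2 * r" using px by (simp add: r_def)
    ultimately have "dist x p + e * r \<le> r" by linarith
    then have "ball p (e * r) \<subseteq> ball x r"
      by (simp add: ball_subset_ball_iff dist_commute)
    from dense[OF r this] obtain z where z: "z \<in> A" "dist p z < e * r" by auto
    have "\<bar>u (p + h *\<^sub>R b) - u (z + h *\<^sub>R b)\<bar> \<le> L * dist p z"
      using lipschitz_onD[OF L, of "p + h *\<^sub>R b" "z + h *\<^sub>R b"] by (simp add: dist_real_def)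
    moreover have "\<bar>u p - u z\<bar> \<le> L * dist p z"
      using lipschitz_onD[OF L, of p z] by (simp add: dist_real_def)
    moreover have "L * dist p z \<le> L * (e * r)"
      using z L0 by (intro mult_left_mono) auto
    moreover have "\<bar>u (z + h *\<^sub>R b) - u z - h * (q \<bullet> b)\<bar> \<le> e * \<bar>h\<bar>"
      using z h s insert.prems by (intro A) auto
    moreover have "e * \<bar>h\<bar> \<le> e * s"
      using h e by (intro mult_left_mono) auto
    ultimately have "\<bar>u (p + h *\<^sub>R b) - u p - h * (q \<bullet> b)\<bar> \<le> e * s + 2 * (L * (e * r))"
      by linarith
    also have "\<dots> = (1 + 4 * real DIM('a) * L) * e * s"
      by (simp add: r_def algebra_simps)
    finally have step: "\<bar>u (p + h *\<^sub>R b) - u p - h * (q \<bullet> b)\<bar> \<le> (1 + 4 * real DIM('a) * L) * e * s" .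
    have IH: "\<bar>u p - u x - (\<Sum>b\<in>B. (v \<bullet> b) * (q \<bullet> b))\<bar> \<le> card B * ((1 + 4 * real DIM('a) * L) * e * s)"
      using insert.IH insert.prems by (simp add: p_def)
    have p': "x + (\<Sum>b\<in>insert b B. (v \<bullet> b) *\<^sub>R b) = p + h *\<^sub>R b"
      using insert.hyps by (simp add: p_def h_def algebra_simps)
    have q': "(\<Sum>b\<in>insert b B. (v \<bullet> b) * (q \<bullet> b)) = h * (q \<bullet> b) + (\<Sum>b\<in>B. (v \<bullet> b) * (q \<bullet> b))"
      using insert.hyps by (simp add: h_def)
    have c': "real (card (insert b B)) * ((1 + 4 * real DIM('a) * L) * e * s) =
        (1 + 4 * real DIM('a) * L) * e * s + card B * ((1 + 4 * real DIM('a) * L) * e * s)"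
      using insert.hyps by (simp add: algebra_simps)
    show ?case
      unfolding p' q' c' using step IH by linarith
  qed simp
  from this[OF finite_Basis subset_refl] show ?thesis
    by (simp add: euclidean_representation v_def s_def euclidean_inner[of q "y - x"] mult.commute mult.left_commute)
qed simp

text \<open>For every tolerance \<open>e\<close>, almost all of the space is covered by countably many sets on which
  all partial difference quotients of \<open>u\<close> are uniformly \<open>e\<close>-close to a fixed vector. At a point where
  such a set is not porous, a coordinate path to any nearby point can be shadowed by points of the
  set.\<close>
theorem Rademacher:
  fixes u :: "'a::euclidean_space \<Rightarrow> real"
  assumes L: "L-lipschitz_on UNIV u"
  shows "negligible {x. \<not> u differentiable (at x)}"
proof -
  define N where "N = (\<Union>b\<in>Basis. {x. \<not> (\<lambda>t. u (x + t *\<^sub>R b)) differentiable (at 0)})"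
  have N: "negligible N"
    unfolding N_def using lipschitz_directionally_differentiable_ae[OF L]
    by (intro negligible_Union) auto
  obtain D :: "'a set" where D: "countable D" "\<And>X. open X \<Longrightarrow> X \<noteq> {} \<Longrightarrow> \<exists>d\<in>D. d \<in> X"
    using countable_dense_setE by blast
  \<comment> \<open>The shift by 2 makes \<open>e k\<close> at most 1/2 already for
    \<open>k = 0\<close>, as the path estimate demands.\<close>
  define e where "e = (\<lambda>k::nat. 1 / real (k + 2))"
  have e: "0 < e k" "e k \<le> 1/2" "e k < 1" for k
    by (auto simp: e_def field_simps)
  define A where "A = (\<lambda>k q (m::nat). {x. \<forall>b\<in>Basis. \<forall>h. \<bar>h\<bar> < 1 / Suc m \<longrightarrow>
      \<bar>u (x + h *\<^sub>R b) - u x - h * (q \<bullet> b)\<bar> \<le> e k * \<bar>h\<bar>})"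
  \<comment> \<open>The points at which \<open>A k q m\<close> is porous form a porous set
    themselves, since holes in \<open>A k q m\<close> are holes in its subsets.\<close>
  define P where "P = (\<lambda>k q m. {x \<in> A k q m. \<forall>d>0. \<exists>r p. 0 < r \<and> r < d \<and>
      ball p (e k * r) \<subseteq> ball x r - A k q m})"
  have P: "negligible (P k q m)" for k q m
  proof (rule negligible_porous[OF e(1,3)])
    fix x and d :: real assume x: "x \<in> P k q m" and d: "0 < d"
    then obtain r p where "0 < r" "r < d" "ball p (e k * r) \<subseteq> ball x r - A k q m"
      unfolding P_def by blast
    moreover have "P k q m \<subseteq> A k q m" by (auto simp: P_def)
    ultimately show "\<exists>r p. 0 < r \<and> r < d \<and> ball p (e k * r) \<subseteq> ball x r - P k q m"
      by blast
  qed
  have PU: "negligible (\<Union>k. \<Union>q\<in>D. \<Union>m. P k q m)"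
  proof -
    have "negligible (\<Union>m. P k q m)" for k q
      using P by (intro negligible_countable_Union) auto
    then have "negligible (\<Union>q\<in>D. \<Union>m. P k q m)" for k
      using D by (intro negligible_countable_Union) auto
    then show ?thesis
      by (intro negligible_countable_Union) auto
  qed
  have "u differentiable (at x)" if xN: "x \<notin> N" and xP: "x \<notin> (\<Union>k. \<Union>q\<in>D. \<Union>m. P k q m)" for x
  proof (rule differentiable_if_approximable)
    fix \<epsilon> :: real assume \<epsilon>: "0 < \<epsilon>"
    \<comment> \<open>The constant of the path estimate; \<open>k\<close> is then chosen with
      \<open>C * e k \<le> \<epsilon>\<close>.\<close>
    define C where "C = real DIM('a) * (1 + 4 * real DIM('a) * L)"
    have C: "C > 0" using lipschitz_on_nonneg[OF L] by (auto simp: C_def intro!: mult_pos_pos add_pos_nonneg)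
    obtain k :: nat where "1 / Suc k < \<epsilon> / C"
      using nat_approx_posE[of "\<epsilon> / C"] C \<epsilon> by auto
    then have "e k < \<epsilon> / C"
      by (rule le_less_trans[rotated]) (auto simp: e_def field_simps)
    then have k: "C * e k \<le> \<epsilon>"
      using C by (simp add: field_simps)
    have "\<exists>l. \<forall>\<^sub>F m in sequentially. \<forall>h. \<bar>h\<bar> < 1 / Suc m \<longrightarrow> \<bar>u (x + h *\<^sub>R b) - u x - h * l\<bar> \<le> e k / 2 * \<bar>h\<bar>"
      if b: "b \<in> Basis" for b
    proof -
      obtain l where l: "\<And>e. 0 < e \<Longrightarrow> \<exists>d>0. \<forall>h. \<bar>h\<bar> < d \<longrightarrow> \<bar>u (x + h *\<^sub>R b) - u x - h * l\<bar> \<le> e * \<bar>h\<bar>"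
        using differentiable_along_lineE[of u x b] xN b by (auto simp: N_def)
      obtain d where d: "0 < d" "\<And>h. \<bar>h\<bar> < d \<Longrightarrow> \<bar>u (x + h *\<^sub>R b) - u x - h * l\<bar> \<le> e k / 2 * \<bar>h\<bar>"
        using l[of "e k / 2"] e(1)[of k] by auto
      have "(\<lambda>m. 1 / real (Suc m)) \<longlonglongrightarrow> 0"
        using LIMSEQ_inverse_real_of_nat by (simp add: divide_inverse)
      then have "\<forall>\<^sub>F m in sequentially. 1 / real (Suc m) < d"
        using d(1) by (rule order_tendstoD)
      then show ?thesis
        using d(2) by (intro exI[of _ l]) (auto elim!: eventually_mono)
    qed
    then have "\<exists>l. \<forall>b\<in>Basis. \<forall>\<^sub>F m in sequentially. \<forall>h. \<bar>h\<bar> < 1 / Suc m \<longrightarrow>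
        \<bar>u (x + h *\<^sub>R b) - u x - h * l b\<bar> \<le> e k / 2 * \<bar>h\<bar>"
      by (intro bchoice) blast
    then obtain l where "\<forall>b\<in>Basis. \<forall>\<^sub>F m in sequentially. \<forall>h. \<bar>h\<bar> < 1 / Suc m \<longrightarrow>
        \<bar>u (x + h *\<^sub>R b) - u x - h * l b\<bar> \<le> e k / 2 * \<bar>h\<bar>"
      by blast
    \<comment> \<open>As there are finitely many coordinates, a single scale \<open>m\<close> serves
      them all.\<close>
    then have "\<forall>\<^sub>F m in sequentially. \<forall>b\<in>Basis. \<forall>h. \<bar>h\<bar> < 1 / Suc m \<longrightarrow>
        \<bar>u (x + h *\<^sub>R b) - u x - h * l b\<bar> \<le> e k / 2 * \<bar>h\<bar>"
      by (intro eventually_ball_finite) auto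
    from eventually_happens'[OF sequentially_bot this]
    obtain m where m: "\<And>b h. b \<in> Basis \<Longrightarrow> \<bar>h\<bar> < 1 / Suc m \<Longrightarrow>
        \<bar>u (x + h *\<^sub>R b) - u x - h * l b\<bar> \<le> e k / 2 * \<bar>h\<bar>"
      by blast
    define g where "g = (\<Sum>b\<in>Basis. l b *\<^sub>R b)"
    have g: "g \<bullet> b = l b" if "b \<in> Basis" for b
      using that by (simp add: g_def inner_sum_left inner_Basis if_distrib[of "\<lambda>z. _ * z"] cong: if_cong)
    \<comment> \<open>Only half the tolerance was spent on the partial derivatives at
      \<open>x\<close>; the other half allows \<open>g\<close> to be replaced by a point of the
      countable dense set.\<close>
    obtain q where q: "q \<in> D" "q \<in> ball g (e k / 2)"
      using D(2)[of "ball g (e k / 2)"] e(1)[of k] by auto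
    have "x \<in> A k q m"
      unfolding A_def
    proof (intro CollectI ballI allI impI)
      fix b :: 'a and h :: real assume b: "b \<in> Basis" and h: "\<bar>h\<bar> < 1 / Suc m"
      have "\<bar>(g - q) \<bullet> b\<bar> \<le> e k / 2"
        using Basis_le_norm[OF b, of "g - q"] q(2) by (simp add: dist_norm)
      then have "\<bar>h\<bar> * \<bar>(g - q) \<bullet> b\<bar> \<le> \<bar>h\<bar> * (e k / 2)"
        by (intro mult_left_mono) auto
      then have "\<bar>h * l b - h * (q \<bullet> b)\<bar> \<le> e k / 2 * \<bar>h\<bar>"
        using g[OF b] by (simp add: abs_mult[symmetric] inner_diff_left right_diff_distrib mult.commute)
      then show "\<bar>u (x + h *\<^sub>R b) - u x - h * (q \<bullet> b)\<bar> \<le> e k * \<bar>h\<bar>"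
        using m[OF b h] by linarith
    qed
    moreover have "x \<notin> P k q m"
      using xP q(1) by blast
    ultimately have "\<not> (\<forall>d>0. \<exists>r p. 0 < r \<and> r < d \<and> ball p (e k * r) \<subseteq> ball x r - A k q m)"
      by (simp add: P_def)
    then obtain d where d: "0 < d" and nd: "\<And>r p. \<lbrakk>0 < r; r < d\<rbrakk> \<Longrightarrow> \<not> ball p (e k * r) \<subseteq> ball x r - A k q m"
      by metis
    \<comment> \<open>The point \<open>x\<close> is in \<open>A k q m\<close> without being one of
      its porous points, so the set has no holes of relative size \<open>e k\<close> near
      \<open>x\<close>.\<close>
    have dense: "\<And>r p. \<lbrakk>0 < r; r < d; ball p (e k * r) \<subseteq> ball x r\<rbrakk> \<Longrightarrow> ball p (e k * r) \<inter> A k q m \<noteq> {}"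
      using nd by (simp add: Diff_eq disjoint_eq_subset_Compl)
    have Aq: "\<And>z b h. \<lbrakk>z \<in> A k q m; b \<in> Basis; \<bar>h\<bar> < 1 / Suc m\<rbrakk> \<Longrightarrow>
        \<bar>u (z + h *\<^sub>R b) - u z - h * (q \<bullet> b)\<bar> \<le> e k * \<bar>h\<bar>"
      by (simp add: A_def)
    define \<rho> where "\<rho> = min (1 / real (Suc m)) (d / (2 * DIM('a)))"
    have "\<rho> > 0" using d by (simp add: \<rho>_def)
    moreover have "\<bar>u y - u x - q \<bullet> (y - x)\<bar> \<le> \<epsilon> * norm (y - x)" if "norm (y - x) < \<rho>" for y
    proof -
      have "\<bar>u y - u x - q \<bullet> (y - x)\<bar> \<le> C * e k * norm (y - x)"
        unfolding C_def
        by (rule approximation_near_nonporous_point[OF L e(1,2) d _ Aq dense])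
           (use that in \<open>auto simp: \<rho>_def\<close>)
      also have "\<dots> \<le> \<epsilon> * norm (y - x)"
        using k by (intro mult_right_mono) auto
      finally show ?thesis .
    qed
    ultimately show "\<exists>q. \<exists>d>0. \<forall>y. norm (y - x) < d \<longrightarrow> \<bar>u y - u x - q \<bullet> (y - x)\<bar> \<le> \<epsilon> * norm (y - x)"
      by blast
  qed
  then have "{x. \<not> u differentiable (at x)} \<subseteq> N \<union> (\<Union>k. \<Union>q\<in>D. \<Union>m. P k q m)"
    by blast
  then show ?thesis
    using negligible_Un[OF N PU] negligible_subset by blast
qed

section \<open>Classical gradients\<close>

lemma grad_eqI:
  fixes u :: "real^'n \<Rightarrow> real"
  assumes "(u has_derivative (\<lambda>h. g \<bullet> h)) (at x)"
  shows "grad u x = g"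
proof -
  have "u differentiable (at x)" using assms by (auto simp: differentiable_def)
  moreover have "frechet_derivative u (at x) = (\<lambda>h. g \<bullet> h)"
    using frechet_derivative_at[OF assms] by simp
  ultimately show ?thesis
    by (simp add: grad_def vec_eq_iff inner_axis)
qed

lemma has_derivative_grad:
  fixes u :: "real^'n \<Rightarrow> real"
  assumes "u differentiable (at x)"
  shows "(u has_derivative (\<lambda>h. grad u x \<bullet> h)) (at x)"
proof -
  obtain D where D: "(u has_derivative D) (at x)"
    using assms by (auto simp: differentiable_def)
  interpret D: bounded_linear D using D by (rule has_derivative_bounded_linear)
  define g where "g = (\<Sum>b\<in>Basis. D b *\<^sub>R b)"
  have "D h = g \<bullet> h" for h
  proof -
    have "D h = D (\<Sum>b\<in>Basis. (h \<bullet> b) *\<^sub>R b)" by (simp add: euclidean_representation)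
    also have "\<dots> = g \<bullet> h"
      by (simp add: D.sum D.scaleR g_def inner_sum_left inner_commute[of h] mult.commute)
    finally show ?thesis .
  qed
  then have "D = (\<lambda>h. g \<bullet> h)" by auto
  then have "(u has_derivative (\<lambda>h. g \<bullet> h)) (at x)"
    using D by simp
  then show ?thesis
    using grad_eqI by metis
qed

lemma grad_not_differentiable: "\<not> u differentiable (at x) \<Longrightarrow> grad u x = 0"
  by (simp add: grad_def)

text \<open>In the direction of its gradient \<open>u\<close> grows at the rate
  \<open>norm (grad u x)\<close>, which \<open>L\<close> bounds. Where \<open>u\<close> is not
  differentiable, \<open>grad\<close> is 0 by default.\<close>

lemma norm_grad_le_lipschitz:
  fixes u :: "real^'n \<Rightarrow> real"
  assumes L: "L-lipschitz_on UNIV u"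
  shows "norm (grad u x) \<le> L"
proof (cases "u differentiable (at x)")
  case True
  define g where "g = grad u x"
  show ?thesis
  proof (rule ccontr)
    assume "\<not> norm (grad u x) \<le> L"
    then have gL: "L < norm g" by (simp add: g_def)
    have L0: "0 \<le> L" by (rule lipschitz_on_nonneg[OF L])
    \<comment> \<open>Half the supposed gap, so that \<open>L + e\<close> is still below
      \<open>norm g\<close>.\<close>
    define e where "e = (norm g - L) / 2"
    have e: "0 < e" using gL by (simp add: e_def)
    obtain d where d: "0 < d" "\<And>y. norm (y - x) < d \<Longrightarrow> \<bar>u y - u x - g \<bullet> (y - x)\<bar> \<le> e * norm (y - x)"
      using has_derivative_grad[OF True] e unfolding has_derivative_at_alt g_def by (metis real_norm_def)
    have ng: "0 < norm g" using gL L0 by linarith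
    define s where "s = d / (2 * norm g)"
    have s: "0 < s" using d(1) ng by (simp add: s_def)
    have "norm (s *\<^sub>R g) < d" using d(1) ng s by (simp add: s_def)
    then have "\<bar>u (x + s *\<^sub>R g) - u x - g \<bullet> (s *\<^sub>R g)\<bar> \<le> e * (s * norm g)"
      using d(2)[of "x + s *\<^sub>R g"] s by simp
    moreover have "\<bar>u (x + s *\<^sub>R g) - u x\<bar> \<le> L * (s * norm g)"
      using lipschitz_onD[OF L, of "x + s *\<^sub>R g" x] s by (simp add: dist_norm)
    moreover have "g \<bullet> (s *\<^sub>R g) = norm g * (s * norm g)"
      by (simp add: power2_norm_eq_inner[symmetric] power2_eq_square)
    ultimately have "norm g * (s * norm g) \<le> L * (s * norm g) + e * (s * norm g)"
      by linarith
    then have "norm g * (s * norm g) \<le> (L + e) * (s * norm g)"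
      by (simp add: distrib_right)
    then have "norm g \<le> L + e" using s ng by simp
    then show False using e gL by (simp add: e_def field_simps)
  qed
next
  case False
  then show ?thesis
    using lipschitz_on_nonneg[OF L] by (simp add: grad_not_differentiable)
qed

lemma grad_scale:
  fixes u :: "real^'n \<Rightarrow> real"
  assumes "u differentiable (at x)"
  shows "grad (\<lambda>x. c * u x) x = c *\<^sub>R grad u x"
  using has_derivative_mult_right[OF has_derivative_grad[OF assms], of c]
  by (intro grad_eqI) (simp add: inner_scaleR_left)

lemma grad_midpoint:
  fixes u w :: "real^'n \<Rightarrow> real"
  assumes "u differentiable (at x)" "w differentiable (at x)"
  shows "grad (\<lambda>x. (u x + w x) / 2) x = (grad u x + grad w x) /\<^sub>R 2"
proof (rule grad_eqI)
  have "((\<lambda>x. (1/2) * (u x + w x)) has_derivative (\<lambda>h. (1/2) * (grad u x \<bullet> h + grad w x \<bullet> h))) (at x)"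
    by (intro has_derivative_mult_right has_derivative_add has_derivative_grad assms)
  then show "((\<lambda>x. (u x + w x) / 2) has_derivative (\<lambda>h. ((grad u x + grad w x) /\<^sub>R 2) \<bullet> h)) (at x)"
    by (simp add: inner_add_left field_simps)
qed

lemma grad_cong_eventually:
  fixes u v :: "real^'n \<Rightarrow> real"
  assumes "\<forall>\<^sub>F y in nhds x. u y = v y" "u differentiable (at x)"
  shows "grad v x = grad u x"
proof (rule grad_eqI)
  have ev: "\<forall>\<^sub>F y in at x. u y = v y"
    using assms(1) eventually_nhds_conv_at by blast
  have "u x = v x" using assms(1) eventually_nhds_x_imp_x by fast
  then show "(v has_derivative (\<lambda>h. grad u x \<bullet> h)) (at x)"
    using has_derivative_transform_eventually[OF has_derivative_grad[OF assms(2)] ev] by simp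
qed

text \<open>A nonnegative function has vanishing derivative wherever it touches zero.\<close>
lemma grad_eq_if_touching:
  fixes u v :: "real^'n \<Rightarrow> real"
  assumes u: "u differentiable (at x)" and v: "v differentiable (at x)"
    and le: "\<And>y. u y \<le> v y" and eq: "u x = v x"
  shows "grad u x = grad v x"
proof -
  have "((\<lambda>y. v y - u y) has_derivative (\<lambda>h. grad v x \<bullet> h - grad u x \<bullet> h)) (at x)"
    by (intro has_derivative_diff has_derivative_grad u v)
  then have "(\<lambda>h. grad v x \<bullet> h - grad u x \<bullet> h) = (\<lambda>h. 0)"
    by (rule has_derivative_local_min) (use le eq in auto)
  then have "(grad v x - grad u x) \<bullet> (grad v x - grad u x) = 0"
    unfolding inner_diff_left by meson
  then show ?thesis by simp
qed

text \<open>Off the contact set the maximum and the minimum each agree near \<open>x\<close> with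
  one of the functions. On it the maximum touches \<open>u\<close> from above and the minimum
  touches \<open>w\<close> from below, so they share these gradients where they are differentiable;
  otherwise \<open>grad\<close> is 0 by default, where \<phi> is smallest. The intended \<phi> is
  \<open>f\<close> of the norm.\<close>

lemma grad_lattice_le:
  fixes u w :: "real^'n \<Rightarrow> real" and \<phi> :: "real^'n \<Rightarrow> real"
  assumes u: "u differentiable (at x)" and w: "w differentiable (at x)"
    and cont: "continuous_on UNIV u" "continuous_on UNIV w"
    and \<phi>: "\<And>p. 0 \<le> \<phi> p" "\<phi> 0 = 0"
  shows "\<phi> (grad (\<lambda>y. max (u y) (w y)) x) + \<phi> (grad (\<lambda>y. min (u y) (w y)) x)
    \<le> \<phi> (grad u x) + \<phi> (grad w x)"
proof -
  let ?M = "\<lambda>y. max (u y) (w y)" and ?m = "\<lambda>y. min (u y) (w y)"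
  have less: "\<forall>\<^sub>F y in nhds x. u y < w y" if "u x < w x"
    using that by (intro eventually_nhds_in_open[of "{y. u y < w y}", simplified] open_Collect_less cont) auto
  have greater: "\<forall>\<^sub>F y in nhds x. w y < u y" if "w x < u x"
    using that by (intro eventually_nhds_in_open[of "{y. w y < u y}", simplified] open_Collect_less cont) auto
  consider "u x < w x" | "w x < u x" | "u x = w x" by linarith
  then show ?thesis
  proof cases
    case 1
    have "grad ?M x = grad w x" "grad ?m x = grad u x"
      by (rule grad_cong_eventually[OF _ w] grad_cong_eventually[OF _ u];
          use less[OF 1] in \<open>auto elim!: eventually_mono\<close>)+
    then show ?thesis by simp
  next
    case 2
    have "grad ?M x = grad u x" "grad ?m x = grad w x"
      by (rule grad_cong_eventually[OF _ w] grad_cong_eventually[OF _ u];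
          use greater[OF 2] in \<open>auto elim!: eventually_mono\<close>)+
    then show ?thesis by simp
  next
    case 3
    have "\<phi> (grad ?M x) \<le> \<phi> (grad u x)"
    proof (cases "?M differentiable (at x)")
      case True
      then have "grad u x = grad ?M x"
        by (rule grad_eq_if_touching[OF u]) (use 3 in auto)
      then show ?thesis by simp
    qed (simp add: grad_not_differentiable \<phi>)
    moreover have "\<phi> (grad ?m x) \<le> \<phi> (grad w x)"
    proof (cases "?m differentiable (at x)")
      case True
      then have "grad ?m x = grad w x"
        by (rule grad_eq_if_touching[OF _ w]) (use 3 in auto)
      then show ?thesis by simp
    qed (simp add: grad_not_differentiable \<phi>)
    ultimately show ?thesis by simp
  qed
qed

text \<open>On the set \<open>D\<close> of full measure each component is a limit of Borel
  difference quotients with steps \<open>1 / Suc k\<close>; off \<open>D\<close> it is the default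
  0. \<open>D\<close> is Lebesgue measurable because its complement is null.\<close>

lemma borel_measurable_grad:
  fixes u :: "real^'n \<Rightarrow> real"
  assumes L: "L-lipschitz_on UNIV u"
  shows "grad u \<in> borel_measurable lebesgue"
  unfolding borel_measurable_euclidean_space[of "grad u"]
proof
  fix b :: "real^'n" assume "b \<in> Basis"
  define D where "D = {x. u differentiable (at x)}"
  define G where "G = (\<lambda>x. lim (\<lambda>k. real (Suc k) * (u (x + (1 / real (Suc k)) *\<^sub>R b) - u x)))"
  have [measurable]: "u \<in> borel_measurable borel"
    using lipschitz_on_continuous_on[OF L] by (rule borel_measurable_continuous_onI)
  have "G \<in> borel_measurable borel"
    unfolding G_def by measurable
  then have G: "G \<in> borel_measurable lebesgue"
    by (simp add: measurable_completion)
  have "- D \<in> null_sets lebesgue"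
    using Rademacher[OF L] by (simp add: D_def Collect_neg_eq negligible_iff_null_sets)
  then have "- (- D) \<in> sets lebesgue"
    by (metis null_setsD2 sets.compl_sets Compl_eq_Diff_UNIV space_completion space_lborel UNIV_I space_borel)
  then have D: "D \<in> sets lebesgue" by simp
  have "grad u x \<bullet> b = (if x \<in> D then G x else 0)" for x
  proof (cases "x \<in> D")
    case True
    then have "((\<lambda>t. u (x + t *\<^sub>R b)) has_derivative (\<lambda>t. grad u x \<bullet> (t *\<^sub>R b))) (at 0)"
      using has_derivative_grad[of u x]
      by (intro has_derivative_compose[of "\<lambda>t. x + t *\<^sub>R b" "\<lambda>t. t *\<^sub>R b" 0 UNIV u, simplified])
         (auto simp: D_def intro!: derivative_eq_intros)
    then have "((\<lambda>t. u (x + t *\<^sub>R b)) has_real_derivative (grad u x \<bullet> b)) (at 0)"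
      by (simp add: has_field_derivative_def mult.commute[of _ "grad u x \<bullet> b"])
    then have lim: "(\<lambda>t. (u (x + t *\<^sub>R b) - u x) / t) \<midarrow>0\<rightarrow> grad u x \<bullet> b"
      by (simp add: DERIV_def)
    have "(\<lambda>k. (u (x + (1 / real (Suc k)) *\<^sub>R b) - u x) / (1 / real (Suc k))) \<longlonglongrightarrow> grad u x \<bullet> b"
    proof (rule filterlim_compose[OF lim])
      have "(\<lambda>k. 1 / real (Suc k)) \<longlonglongrightarrow> 0"
        using LIMSEQ_inverse_real_of_nat by (simp add: divide_inverse)
      then show "filterlim (\<lambda>k. 1 / real (Suc k)) (at 0) sequentially"
        by (simp add: filterlim_at)
    qed
    then have "G x = grad u x \<bullet> b"
      unfolding G_def by (intro limI) (simp add: mult.commute)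
    then show ?thesis using True by simp
  qed (simp add: D_def grad_not_differentiable)
  then have "(\<lambda>x. grad u x \<bullet> b) = (\<lambda>x. if x \<in> D then G x else 0)" by auto
  also have "\<dots> \<in> borel_measurable lebesgue"
    using G D by (intro measurable_If_set) auto
  finally show "(\<lambda>x. grad u x \<bullet> b) \<in> borel_measurable lebesgue" .
qed

section \<open>The energy density\<close>

lemma energy_density_mvt:
  assumes "cond_f1 f f'" "0 \<le> s" "s < t"
  obtains z where "s < z" "z < t" "f t - f s = f' z * (t - s)"
proof -
  \<comment> \<open>At 0 only a one-sided derivative is available, so the mean value theorem is used
    relative to \<open>{s..t}\<close>.\<close>
  have "(f has_derivative (*) (f' x)) (at x within {s..t})" if "s \<le> x" "x \<le> t" for x
  proof (rule has_derivative_subset)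
    show "(f has_derivative (*) (f' x)) (at x within {0..})"
      using assms that by (simp add: cond_f1_def has_field_derivative_def)
  qed (use assms in auto)
  from mvt_simple[OF \<open>s < t\<close> this] show thesis
    using that by auto
qed

lemma energy_density_continuous:
  assumes "cond_f1 f f'"
  shows "continuous_on {0..} f"
  using assms unfolding cond_f1_def by (intro DERIV_continuous_on[where D=f']) simp

lemma energy_density_mono:
  assumes "cond_f1 f f'" "0 \<le> s" "s \<le> t"
  shows "f s \<le> f t"
  using assms mono_onD[of "{0..}" f s t] by (simp add: cond_f1_def)

lemma energy_density_nonneg:
  assumes "cond_f1 f f'" "0 \<le> s"
  shows "0 \<le> f s"
  using energy_density_mono[OF assms(1), of 0 s] assms by (simp add: cond_f1_def)

lemma energy_density_flat:
  assumes "cond_f1 f f'" "cond_f2 f f' \<sigma>" "0 \<le> s" "s \<le> \<sigma>"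
  shows "f s = 0"
proof (cases "s = 0")
  case False
  then obtain z where "0 < z" "z < s" "f s - f 0 = f' z * (s - 0)"
    using energy_density_mvt[OF assms(1), of 0 s] assms by auto
  then show ?thesis
    using assms by (simp add: cond_f1_def cond_f2_def)
qed (use assms in \<open>simp add: cond_f1_def\<close>)

lemma energy_density_deriv_strict_mono:
  assumes "cond_f2 f f' \<sigma>" "\<sigma> < s" "s < t"
  shows "f' s < f' t"
proof -
  have "\<exists>f''. (\<forall>s>\<sigma>. (f' has_real_derivative f'' s) (at s)) \<and> (\<forall>s>\<sigma>. f'' s > 0)"
    using assms(1) unfolding cond_f2_def by (elim conjE exE) (rule exI, rule conjI)
  then obtain f'' where f'': "\<forall>s>\<sigma>. (f' has_real_derivative f'' s) (at s)" "\<forall>s>\<sigma>. f'' s > 0"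
    by (elim exE conjE)
  show ?thesis
    by (rule DERIV_pos_imp_increasing[OF \<open>s < t\<close>]) (use f'' assms(2) in \<open>meson less_le_trans\<close>)
qed

text \<open>Mean value points \<open>y < z\<close> in the two halves satisfy
  \<open>f' z \<le> f' y\<close> by the midpoint inequality. As \<open>f'\<close> vanishes up to
  \<sigma> and is positive and strictly increasing beyond, both slopes must vanish, and then
  \<open>f\<close> does not change from \<open>s\<close> to \<open>t\<close>.\<close>

lemma energy_density_midpoint_eq:
  assumes f1: "cond_f1 f f'" and f2: "cond_f2 f f' \<sigma>" and st: "0 \<le> s" "s < t"
    and mid: "(f s + f t) / 2 \<le> f ((s + t) / 2)"
  shows "f s = f t"
proof (rule ccontr)
  assume ne: "f s \<noteq> f t"
  define m where "m = (s + t) / 2"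
  have m: "s < m" "m < t" "t - m = m - s" using st by (auto simp: m_def field_simps)
  obtain y where y: "s < y" "y < m" "f m - f s = f' y * (m - s)"
    using energy_density_mvt[OF f1 st(1) m(1)] .
  obtain z where z: "m < z" "z < t" "f t - f m = f' z * (t - m)"
    using energy_density_mvt[OF f1 _ m(2)] st m by auto
  have "f t - f m \<le> f m - f s"
    using mid unfolding m_def[symmetric] by simp
  moreover have "f t - f m = f' z * (m - s)"
    using z(3) unfolding m(3) .
  ultimately have "f' z * (m - s) \<le> f' y * (m - s)"
    using y(3) by linarith
  then have le: "f' z \<le> f' y" using m by simp
  show False
  proof (cases "z \<le> \<sigma>")
    case True
    then have "f' z = 0" "f' y = 0"
      using f2 y z m st by (auto simp: cond_f2_def)
    then show False using y z ne by simp
  next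
    case False
    then have "0 < f' z" using f2 by (simp add: cond_f2_def)
    moreover have "f' y = 0" if "y \<le> \<sigma>"
      using that f2 y st by (simp add: cond_f2_def)
    moreover have "f' y < f' z" if "\<sigma> < y"
      using energy_density_deriv_strict_mono[OF f2 that] y z by simp
    ultimately show False using le by (cases "y \<le> \<sigma>") auto
  qed
qed

lemma energy_density_midpoint_le:
  fixes p q :: "'a::real_normed_vector"
  assumes f1: "cond_f1 f f'"
  shows "f (norm ((p + q) /\<^sub>R 2)) \<le> f ((norm p + norm q) / 2)"
    and "f ((norm p + norm q) / 2) \<le> (f (norm p) + f (norm q)) / 2"
proof -
  show "f (norm ((p + q) /\<^sub>R 2)) \<le> f ((norm p + norm q) / 2)"
    using norm_triangle_ineq[of p q] by (intro energy_density_mono[OF f1]) auto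
  have "convex_on {0..} f" using f1 by (simp add: cond_f1_def)
  from convex_onD[OF this, of "1/2" "norm p" "norm q"]
  show "f ((norm p + norm q) / 2) \<le> (f (norm p) + f (norm q)) / 2"
    by (simp add: field_simps)
qed

text \<open>By the triangle inequality and monotonicity, equality for the vectors forces the
  reversed scalar midpoint inequality for their norms.\<close>

lemma energy_density_midpoint_norm_eq:
  fixes p q :: "'a::real_normed_vector"
  assumes f1: "cond_f1 f f'" and f2: "cond_f2 f f' \<sigma>"
    and mid: "f (norm ((p + q) /\<^sub>R 2)) = (f (norm p) + f (norm q)) / 2"
  shows "f (norm p) = f (norm q)"
proof -
  have "(f (norm p) + f (norm q)) / 2 \<le> f ((norm p + norm q) / 2)"
    using energy_density_midpoint_le(1)[OF f1, of p q] mid by simp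
  then show ?thesis
    using energy_density_midpoint_eq[OF f1 f2, of "norm p" "norm q"]
      energy_density_midpoint_eq[OF f1 f2, of "norm q" "norm p"]
    by (cases "norm p" "norm q" rule: linorder_cases) (auto simp: add.commute)
qed

text \<open>Both \<open>f\<close> and \<open>f'\<close> vanish at \<sigma>, so stretching the slope
  \<sigma> by the factor \<open>1 + t\<close> costs only o(t).\<close>

lemma energy_density_flat_tangent:
  assumes f1: "cond_f1 f f'" and f2: "cond_f2 f f' \<sigma>" and "0 < \<sigma>" "0 < e"
  obtains t where "0 < t" "f ((1 + t) * \<sigma>) \<le> e * t"
proof -
  have "(f has_derivative (*) (f' \<sigma>)) (at \<sigma> within {0..})"
    using f1 \<open>0 < \<sigma>\<close> by (simp add: cond_f1_def has_field_derivative_def)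
  moreover have "f' \<sigma> = 0" "f \<sigma> = 0"
    using f2 \<open>0 < \<sigma>\<close> energy_density_flat[OF f1 f2, of \<sigma>] by (auto simp: cond_f2_def)
  \<comment> \<open>The tolerance is \<open>e / \<sigma>\<close> because the step from \<sigma> to
    \<open>(1 + t) * \<sigma>\<close> has length \<open>t * \<sigma>\<close>.\<close>
  ultimately obtain d where d: "0 < d" "\<And>y. 0 \<le> y \<Longrightarrow> \<bar>y - \<sigma>\<bar> < d \<Longrightarrow> \<bar>f y\<bar> \<le> e / \<sigma> * \<bar>y - \<sigma>\<bar>"
    unfolding has_derivative_within_alt using \<open>0 < \<sigma>\<close> \<open>0 < e\<close>
    by (auto dest!: spec[of _ "e / \<sigma>"])
  define t where "t = d / (2 * \<sigma>)"
  have t: "0 < t" "t * \<sigma> < d" using d(1) \<open>0 < \<sigma>\<close> by (auto simp: t_def)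
  have "\<bar>f ((1 + t) * \<sigma>)\<bar> \<le> e / \<sigma> * \<bar>(1 + t) * \<sigma> - \<sigma>\<bar>"
    using t \<open>0 < \<sigma>\<close> by (intro d(2)) (auto simp: algebra_simps)
  also have "\<dots> = e * t" using t \<open>0 < \<sigma>\<close> by (simp add: algebra_simps)
  finally show thesis using that t by auto
qed

section \<open>The space of admissible functions\<close>

lemma W1inf0_lattice:
  assumes "u \<in> W1inf0 \<Omega>" "w \<in> W1inf0 \<Omega>"
  shows "(\<lambda>x. max (u x) (w x)) \<in> W1inf0 \<Omega>" "(\<lambda>x. min (u x) (w x)) \<in> W1inf0 \<Omega>"
proof -
  obtain L K where L: "L-lipschitz_on UNIV u" and K: "K-lipschitz_on UNIV w"
    using assms by (auto simp: W1inf0_def)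
  have le: "\<bar>u x - u y\<bar> \<le> max L K * dist x y" "\<bar>w x - w y\<bar> \<le> max L K * dist x y" for x y
  proof -
    have "L * dist x y \<le> max L K * dist x y" "K * dist x y \<le> max L K * dist x y"
      by (auto intro: mult_right_mono)
    then show "\<bar>u x - u y\<bar> \<le> max L K * dist x y" "\<bar>w x - w y\<bar> \<le> max L K * dist x y"
      using lipschitz_onD[OF L, of x y] lipschitz_onD[OF K, of x y] by (auto simp: dist_real_def)
  qed
  have aux: "\<bar>max a b - max c d\<bar> \<le> r" "\<bar>min a b - min c d\<bar> \<le> r"
    if "\<bar>a - c\<bar> \<le> r" "\<bar>b - d\<bar> \<le> r" for a b c d r :: real
    using that by linarith+
  have "0 \<le> max L K" using lipschitz_on_nonneg[OF L] by simp
  then have "(max L K)-lipschitz_on UNIV (\<lambda>x. max (u x) (w x))"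
      "(max L K)-lipschitz_on UNIV (\<lambda>x. min (u x) (w x))"
    by (intro lipschitz_onI; simp only: dist_real_def aux[OF le])+
  then show "(\<lambda>x. max (u x) (w x)) \<in> W1inf0 \<Omega>" "(\<lambda>x. min (u x) (w x)) \<in> W1inf0 \<Omega>"
    using assms by (auto simp: W1inf0_def)
qed

lemma W1inf0_midpoint:
  assumes "u \<in> W1inf0 \<Omega>" "w \<in> W1inf0 \<Omega>"
  shows "(\<lambda>x. (u x + w x) / 2) \<in> W1inf0 \<Omega>"
proof -
  obtain L K where "L-lipschitz_on UNIV u" "K-lipschitz_on UNIV w"
    using assms by (auto simp: W1inf0_def)
  then have "(\<bar>1/2\<bar> * (L + K))-lipschitz_on UNIV (\<lambda>x. (1/2) * (u x + w x))"
    by (intro lipschitz_on_cmult_real lipschitz_on_add)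
  then show ?thesis
    using assms by (auto simp: W1inf0_def)
qed

lemma W1inf0_cmult:
  assumes "u \<in> W1inf0 \<Omega>"
  shows "(\<lambda>x. c * u x) \<in> W1inf0 \<Omega>"
proof -
  obtain L where "L-lipschitz_on UNIV u" using assms by (auto simp: W1inf0_def)
  then have "(\<bar>c\<bar> * L)-lipschitz_on UNIV (\<lambda>x. c * u x)"
    by (rule lipschitz_on_cmult_real)
  then show ?thesis
    using assms by (auto simp: W1inf0_def)
qed

text \<open>With \<open>c = \<sigma>\<close> this is the competitor of the steepness argument: its
  slope never exceeds \<sigma>, so it pays no gradient energy.\<close>

lemma W1inf0_infdist:
  assumes "- \<Omega> \<noteq> {}" "0 \<le> c"
  shows "c-lipschitz_on UNIV (\<lambda>x. c * infdist x (- \<Omega>))" "(\<lambda>x. c * infdist x (- \<Omega>)) \<in> W1inf0 \<Omega>"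
proof -
  have "\<bar>infdist x (- \<Omega>) - infdist y (- \<Omega>)\<bar> \<le> dist x y" for x y
    using infdist_triangle_abs by blast
  then have "1-lipschitz_on UNIV (\<lambda>x. infdist x (- \<Omega>))"
    by (intro lipschitz_onI) (auto simp: dist_real_def)
  from lipschitz_on_cmult_real[OF this, of c]
  show "c-lipschitz_on UNIV (\<lambda>x. c * infdist x (- \<Omega>))" using assms by simp
  then show "(\<lambda>x. c * infdist x (- \<Omega>)) \<in> W1inf0 \<Omega>"
    unfolding W1inf0_def by (auto simp: infdist_zero)
qed

lemma W1inf0_differentiable_ae:
  fixes u :: "real^'n \<Rightarrow> real"
  assumes "u \<in> W1inf0 \<Omega>" "open \<Omega>"
  shows "AE x in lebesgue_on \<Omega>. u differentiable (at x)"
proof -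
  obtain L where "L-lipschitz_on UNIV u" using assms by (auto simp: W1inf0_def)
  then have "{x. \<not> u differentiable (at x)} \<in> null_sets lebesgue"
    using Rademacher negligible_iff_null_sets by blast
  then have "AE x in lebesgue. u differentiable (at x)"
    by (rule AE_I') auto
  then show ?thesis
    using \<open>open \<Omega>\<close> by (subst AE_restrict_space_iff) auto
qed

lemma W1inf0_continuous:
  assumes "u \<in> W1inf0 \<Omega>"
  shows "continuous_on UNIV u"
proof -
  obtain L where "L-lipschitz_on UNIV u" using assms by (auto simp: W1inf0_def)
  then show ?thesis by (rule lipschitz_on_continuous_on)
qed

text \<open>Both functions are bounded on a set of finite measure: \<open>u\<close> by compactness
  of \<open>closure \<Omega>\<close>, the energy density because gradient norms stay in
  \<open>{0..L}\<close>.\<close>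

lemma W1inf0_integrable:
  fixes u :: "real^'n \<Rightarrow> real" and f :: "real \<Rightarrow> real"
  assumes u: "u \<in> W1inf0 \<Omega>" and \<Omega>: "open \<Omega>" "bounded \<Omega>"
  shows "integrable (lebesgue_on \<Omega>) u"
    and "continuous_on {0..} f \<Longrightarrow> integrable (lebesgue_on \<Omega>) (\<lambda>x. f (norm (grad u x)))"
proof -
  obtain L where L: "L-lipschitz_on UNIV u" using u by (auto simp: W1inf0_def)
  have lm: "\<Omega> \<in> lmeasurable"
    using \<Omega> by (simp add: lmeasurable_open)
  interpret finite_measure "lebesgue_on \<Omega>"
    by (rule finite_measure_lebesgue_on[OF lm])
  have "compact (u ` closure \<Omega>)"
    using W1inf0_continuous[OF u] \<Omega> by (intro compact_continuous_image) (auto intro: continuous_on_subset)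
  then obtain B where B: "\<And>x. x \<in> closure \<Omega> \<Longrightarrow> norm (u x) \<le> B"
    using compact_imp_bounded[of "u ` closure \<Omega>"] by (auto simp: bounded_iff)
  have "u \<in> borel_measurable borel"
    using W1inf0_continuous[OF u] by (rule borel_measurable_continuous_onI)
  then have "u \<in> borel_measurable (lebesgue_on \<Omega>)"
    by (intro measurable_restrict_space1 measurable_completion) simp
  then show "integrable (lebesgue_on \<Omega>) u"
    using B closure_subset[of \<Omega>] by (intro integrable_const_bound[of _ B]) (auto intro!: AE_I2)
  assume f: "continuous_on {0..} f"
  \<comment> \<open>Continuity of \<open>f\<close> is given on \<open>{0..}\<close> only; clamping
    the argument at 0 yields a function continuous on the whole line that agrees with
    \<open>f\<close> at every norm.\<close>
  define F where "F = (\<lambda>s. f (max 0 s))"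
  have "continuous_on UNIV F"
    unfolding F_def by (intro continuous_on_compose2[OF f] continuous_intros) auto
  then have F: "F \<in> borel_measurable borel"
    by (rule borel_measurable_continuous_onI)
  have "(\<lambda>x. norm (grad u x)) \<in> borel_measurable lebesgue"
    using borel_measurable_grad[OF L] by measurable
  then have "(\<lambda>x. F (norm (grad u x))) \<in> borel_measurable lebesgue"
    by (rule measurable_compose[OF _ F])
  then have meas: "(\<lambda>x. f (norm (grad u x))) \<in> borel_measurable (lebesgue_on \<Omega>)"
    by (intro measurable_restrict_space1) (simp add: F_def)
  have "compact (f ` {0..L})"
    using f by (intro compact_continuous_image) (auto intro: continuous_on_subset)
  then obtain C where C: "\<forall>s\<in>{0..L}. norm (f s) \<le> C"
    using compact_imp_bounded[of "f ` {0..L}"] by (auto simp: bounded_iff)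
  show "integrable (lebesgue_on \<Omega>) (\<lambda>x. f (norm (grad u x)))"
    using C norm_grad_le_lipschitz[OF L] meas by (intro integrable_const_bound[of _ C]) auto
qed

lemma I_Omega_eq:
  fixes u :: "real^'n \<Rightarrow> real"
  assumes "u \<in> W1inf0 \<Omega>" "open \<Omega>" "bounded \<Omega>" "cond_f1 f f'"
  shows "I_Omega f \<Omega> u = (\<integral>x. f (norm (grad u x)) \<partial>lebesgue_on \<Omega>) - (\<integral>x. u x \<partial>lebesgue_on \<Omega>)"
  unfolding I_Omega_def
  by (rule Bochner_Integration.integral_diff)
     (rule W1inf0_integrable[OF assms(1-3)] energy_density_continuous[OF assms(4)])+

text \<open>The points of \<Omega> with \<open>v \<noteq> 0\<close> form an open set, and a nonempty
  open set is not null.\<close>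

lemma continuous_AE_zero_on_open:
  fixes v :: "'a::euclidean_space \<Rightarrow> real"
  assumes "open \<Omega>" "continuous_on UNIV v" "AE x in lebesgue_on \<Omega>. v x = 0" "x \<in> \<Omega>"
  shows "v x = 0"
proof -
  have "AE y in lebesgue. y \<in> \<Omega> \<longrightarrow> v y = 0"
    using assms(3) \<open>open \<Omega>\<close> by (subst (asm) AE_restrict_space_iff) auto
  then obtain N where N: "N \<in> null_sets lebesgue" "\<And>y. y \<in> UNIV - N \<Longrightarrow> y \<in> \<Omega> \<longrightarrow> v y = 0"
    by (rule AE_E3) simp
  then have "negligible N" "\<Omega> \<inter> {y. v y \<noteq> 0} \<subseteq> N"
    using negligible_iff_null_sets by auto
  then have "negligible (\<Omega> \<inter> {y. v y \<noteq> 0})"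
    by (rule negligible_subset)
  moreover have "open (\<Omega> \<inter> {y. v y \<noteq> 0})"
    using assms(1,2) by (intro open_Int open_Collect_neq continuous_intros) auto
  ultimately have "\<Omega> \<inter> {y. v y \<noteq> 0} = {}"
    using open_not_negligible by blast
  then show ?thesis using \<open>x \<in> \<Omega>\<close> by blast
qed

section \<open>Minimizers\<close>

text \<open>The linear part of the energy is exactly averaged at the midpoint, so minimality leaves
  no room for a convexity gap in the gradient part. Without a gap the densities agree almost
  everywhere, and equal energies then give equal integrals.\<close>

lemma minimizers_integral_eq:
  fixes u w :: "real^'n \<Rightarrow> real"
  assumes \<Omega>: "open \<Omega>" "bounded \<Omega>" and f: "cond_f1 f f'" "cond_f2 f f' \<sigma>"
    and u: "is_minimizer f \<Omega> u" and w: "is_minimizer f \<Omega> w"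
  shows "(\<integral>x. u x \<partial>lebesgue_on \<Omega>) = (\<integral>x. w x \<partial>lebesgue_on \<Omega>)"
proof -
  let ?M = "lebesgue_on \<Omega>"
  let ?E = "\<lambda>v x. f (norm (grad v x))"
  let ?z = "\<lambda>x. (u x + w x) / 2"
  have W: "u \<in> W1inf0 \<Omega>" "w \<in> W1inf0 \<Omega>" "?z \<in> W1inf0 \<Omega>"
    using u w W1inf0_midpoint by (auto simp: is_minimizer_def)
  note cont = energy_density_continuous[OF f(1)]
  note int = W1inf0_integrable[OF _ \<Omega>]
  note intE = int(2)[OF _ cont]
  note I = I_Omega_eq[OF _ \<Omega> f(1)]
  have eq: "I_Omega f \<Omega> u = I_Omega f \<Omega> w" and le: "I_Omega f \<Omega> u \<le> I_Omega f \<Omega> ?z"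
    using u w W by (auto simp: is_minimizer_def intro: order_antisym)
  have z: "(\<integral>x. ?z x \<partial>?M) = ((\<integral>x. u x \<partial>?M) + (\<integral>x. w x \<partial>?M)) / 2"
    using int(1)[OF W(1)] int(1)[OF W(2)] by simp
  \<comment> \<open>The pointwise convexity gap at the midpoint.\<close>
  define g where "g = (\<lambda>x. (?E u x + ?E w x) / 2 - ?E ?z x)"
  have g_int: "integrable ?M g"
    unfolding g_def using intE[OF W(1)] intE[OF W(2)] intE[OF W(3)] by auto
  have pt: "AE x in ?M. 0 \<le> g x \<and> (g x = 0 \<longrightarrow> ?E u x = ?E w x)"
    using W1inf0_differentiable_ae[OF W(1) \<Omega>(1)] W1inf0_differentiable_ae[OF W(2) \<Omega>(1)]
  proof eventually_elim
    case (elim x)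
    then have "grad ?z x = (grad u x + grad w x) /\<^sub>R 2"
      by (rule grad_midpoint)
    then have gx: "g x = (?E u x + ?E w x) / 2 - f (norm ((grad u x + grad w x) /\<^sub>R 2))"
      by (simp only: g_def)
    have "0 \<le> g x"
      unfolding gx using energy_density_midpoint_le[OF f(1), of "grad u x" "grad w x"] by linarith
    moreover have "?E u x = ?E w x" if "g x = 0"
      by (rule energy_density_midpoint_norm_eq[OF f]) (use that gx in linarith)
    ultimately show ?case by blast
  qed
  have "(\<integral>x. g x \<partial>?M) = ((\<integral>x. ?E u x \<partial>?M) + (\<integral>x. ?E w x \<partial>?M)) / 2 - (\<integral>x. ?E ?z x \<partial>?M)"
    unfolding g_def using intE[OF W(1)] intE[OF W(2)] intE[OF W(3)] by simp
  also have "\<dots> \<le> 0"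
  proof -
    \<comment> \<open>Here \<open>a\<close>, \<open>c\<close>, \<open>k\<close> are the gradient
      energies of \<open>u\<close>, \<open>w\<close> and their midpoint, and \<open>b\<close>,
      \<open>d\<close>, \<open>l\<close> the integrals of these functions.\<close>
    have "a - b = c - d \<Longrightarrow> a - b \<le> k - l \<Longrightarrow> l = (b + d) / 2 \<Longrightarrow> (a + c) / 2 - k \<le> 0"
      for a b c d k l :: real
      by (simp add: field_simps)
    from this[OF eq[unfolded I[OF W(1)] I[OF W(2)]] le[unfolded I[OF W(1)] I[OF W(3)]] z]
    show ?thesis .
  qed
  finally have "(\<integral>x. g x \<partial>?M) \<le> 0" .
  moreover have nn: "AE x in ?M. 0 \<le> g x" using pt by auto
  ultimately have "(\<integral>x. g x \<partial>?M) = 0"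
    using integral_nonneg_AE[OF nn] by linarith
  then have "AE x in ?M. g x = 0"
    using integral_nonneg_eq_0_iff_AE[OF g_int nn] by simp
  with pt have "AE x in ?M. ?E u x = ?E w x" by auto
  then have "(\<integral>x. ?E u x \<partial>?M) = (\<integral>x. ?E w x \<partial>?M)"
    using intE[OF W(1)] intE[OF W(2)] by (intro integral_cong_AE) auto
  then show ?thesis
    using eq unfolding I[OF W(1)] I[OF W(2)] by simp
qed

text \<open>Passing to maximum and minimum keeps the sum of the integrals and does not raise the
  total gradient energy. As the minimum costs at least as much as \<open>w\<close>, the maximum
  costs at most as much as \<open>u\<close>.\<close>

lemma minimizer_max:
  fixes u w :: "real^'n \<Rightarrow> real"
  assumes \<Omega>: "open \<Omega>" "bounded \<Omega>" and f: "cond_f1 f f'"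
    and u: "is_minimizer f \<Omega> u" and w: "is_minimizer f \<Omega> w"
  shows "is_minimizer f \<Omega> (\<lambda>x. max (u x) (w x))"
proof -
  let ?M = "lebesgue_on \<Omega>"
  let ?E = "\<lambda>v x. f (norm (grad v x))"
  let ?y = "\<lambda>x. max (u x) (w x)" and ?z = "\<lambda>x. min (u x) (w x)"
  have W: "u \<in> W1inf0 \<Omega>" "w \<in> W1inf0 \<Omega>"
    using u w by (auto simp: is_minimizer_def)
  note W' = W1inf0_lattice[OF W]
  note int = W1inf0_integrable(1)[OF _ \<Omega>]
  note intE = W1inf0_integrable(2)[OF _ \<Omega> energy_density_continuous[OF f]]
  note I = I_Omega_eq[OF _ \<Omega> f]
  have "(\<integral>x. ?E ?y x \<partial>?M) + (\<integral>x. ?E ?z x \<partial>?M) = (\<integral>x. ?E ?y x + ?E ?z x \<partial>?M)"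
    using intE[OF W'(1)] intE[OF W'(2)] by simp
  also have "\<dots> \<le> (\<integral>x. ?E u x + ?E w x \<partial>?M)"
  proof (rule integral_mono_AE)
    show "AE x in ?M. ?E ?y x + ?E ?z x \<le> ?E u x + ?E w x"
      using W1inf0_differentiable_ae[OF W(1) \<Omega>(1)] W1inf0_differentiable_ae[OF W(2) \<Omega>(1)]
    proof eventually_elim
      case (elim x)
      show ?case
        by (rule grad_lattice_le[OF elim W1inf0_continuous[OF W(1)] W1inf0_continuous[OF W(2)],
              where \<phi>="\<lambda>p. f (norm p)"])
           (use f energy_density_nonneg[OF f] in \<open>auto simp: cond_f1_def\<close>)
    qed
  qed (use intE[OF W(1)] intE[OF W(2)] intE[OF W'(1)] intE[OF W'(2)] in auto)
  also have "\<dots> = (\<integral>x. ?E u x \<partial>?M) + (\<integral>x. ?E w x \<partial>?M)"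
    using intE[OF W(1)] intE[OF W(2)] by simp
  finally have E: "(\<integral>x. ?E ?y x \<partial>?M) + (\<integral>x. ?E ?z x \<partial>?M) \<le> (\<integral>x. ?E u x \<partial>?M) + (\<integral>x. ?E w x \<partial>?M)" .
  have "(\<integral>x. ?y x \<partial>?M) + (\<integral>x. ?z x \<partial>?M) = (\<integral>x. ?y x + ?z x \<partial>?M)"
    using int[OF W'(1)] int[OF W'(2)] by simp
  also have "\<dots> = (\<integral>x. u x + w x \<partial>?M)"
    by (intro Bochner_Integration.integral_cong) (auto simp: max_def min_def)
  also have "\<dots> = (\<integral>x. u x \<partial>?M) + (\<integral>x. w x \<partial>?M)"
    using int[OF W(1)] int[OF W(2)] by simp
  finally have "I_Omega f \<Omega> ?y + I_Omega f \<Omega> ?z \<le> I_Omega f \<Omega> u + I_Omega f \<Omega> w"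
    using E unfolding I[OF W(1)] I[OF W(2)] I[OF W'(1)] I[OF W'(2)] by linarith
  moreover have "I_Omega f \<Omega> w \<le> I_Omega f \<Omega> ?z"
    using w W'(2) by (auto simp: is_minimizer_def)
  ultimately have "I_Omega f \<Omega> ?y \<le> I_Omega f \<Omega> u" by linarith
  then show ?thesis
    using u W'(1) unfolding is_minimizer_def by (meson order_trans)
qed

text \<open>The continuous nonnegative function \<open>max (u x) (w x) - u x\<close> has integral 0
  over \<Omega> and so vanishes there. Exchanging the roles of \<open>u\<close> and \<open>w\<close>
  yields uniqueness.\<close>

lemma minimizer_le_minimizer:
  fixes u w :: "real^'n \<Rightarrow> real"
  assumes \<Omega>: "open \<Omega>" "bounded \<Omega>" and f: "cond_f1 f f'" "cond_f2 f f' \<sigma>"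
    and u: "is_minimizer f \<Omega> u" and w: "is_minimizer f \<Omega> w"
  shows "w x \<le> u x"
proof (cases "x \<in> \<Omega>")
  case True
  let ?M = "lebesgue_on \<Omega>"
  let ?y = "\<lambda>x. max (u x) (w x)"
  have y: "is_minimizer f \<Omega> ?y"
    by (rule minimizer_max[OF \<Omega> f(1) u w])
  have W: "u \<in> W1inf0 \<Omega>" "?y \<in> W1inf0 \<Omega>"
    using u y by (auto simp: is_minimizer_def)
  note int = W1inf0_integrable(1)[OF W(1) \<Omega>] W1inf0_integrable(1)[OF W(2) \<Omega>]
  have "(\<integral>x. ?y x - u x \<partial>?M) = 0"
    using int minimizers_integral_eq[OF \<Omega> f u y] by simp
  then have "AE x in ?M. ?y x - u x = 0"
    using int by (subst (asm) integral_nonneg_eq_0_iff_AE) auto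
  then have "?y x - u x = 0"
    using True W by (intro continuous_AE_zero_on_open[OF \<Omega>(1), of "\<lambda>x. ?y x - u x"])
      (auto intro!: continuous_on_diff intro: W1inf0_continuous)
  then show ?thesis by simp
next
  case False
  then show ?thesis using u w by (auto simp: is_minimizer_def W1inf0_def)
qed

section \<open>Steepness of the minimizer\<close>

lemma minimizer_steep:
  fixes u :: "real^'n \<Rightarrow> real"
  assumes \<Omega>: "open \<Omega>" "bounded \<Omega>" "\<Omega> \<noteq> {}" and f: "cond_f1 f f'" "cond_f2 f f' \<sigma>" and "\<sigma> > 0"
    and u: "is_minimizer f \<Omega> u"
  shows "emeasure lebesgue {x \<in> \<Omega>. norm (grad u x) > \<sigma>} > 0"
proof (rule ccontr)
  assume "\<not> ?thesis"
  then have zero: "emeasure lebesgue {x \<in> \<Omega>. norm (grad u x) > \<sigma>} = 0"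
    by (simp add: not_gr_zero)
  let ?M = "lebesgue_on \<Omega>"
  let ?E = "\<lambda>v x. f (norm (grad v x))"
  have Wu: "u \<in> W1inf0 \<Omega>" using u by (simp add: is_minimizer_def)
  obtain L where L: "L-lipschitz_on UNIV u" using Wu by (auto simp: W1inf0_def)
  note int = W1inf0_integrable(1)[OF _ \<Omega>(1,2)]
  note intE = W1inf0_integrable(2)[OF _ \<Omega>(1,2) energy_density_continuous[OF f(1)]]
  note I = I_Omega_eq[OF _ \<Omega>(1,2) f(1)]
  \<comment> \<open>\<open>emeasure\<close> is 0 on non-measurable sets as well, so measurability
    must be shown before \<open>zero\<close> can give a null set.\<close>
  have "(\<lambda>x. norm (grad u x)) \<in> borel_measurable lebesgue"
    using borel_measurable_grad[OF L] by measurable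
  then have "{x. norm (grad u x) > \<sigma>} \<in> sets lebesgue"
    using borel_measurable_iff_greater[of "\<lambda>x. norm (grad u x)" lebesgue] by simp
  then have "\<Omega> \<inter> {x. norm (grad u x) > \<sigma>} \<in> sets lebesgue"
    using \<Omega>(1) by (intro sets.Int) auto
  then have "{x \<in> \<Omega>. norm (grad u x) > \<sigma>} \<in> null_sets lebesgue"
    using zero by (auto simp: null_sets_def Int_def)
  then have "AE x in lebesgue. x \<in> \<Omega> \<longrightarrow> norm (grad u x) \<le> \<sigma>"
    by (rule AE_I') auto
  then have shallow: "AE x in ?M. norm (grad u x) \<le> \<sigma>"
    using \<Omega>(1) by (subst AE_restrict_space_iff) auto
  have "(\<integral>x. ?E u x \<partial>?M) = (\<integral>x. 0 \<partial>?M)"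
    using intE[OF Wu] shallow by (intro integral_cong_AE) (auto simp: energy_density_flat[OF f])
  then have Iu: "I_Omega f \<Omega> u = - (\<integral>x. u x \<partial>?M)"
    using I[OF Wu] by simp

  define v where "v = (\<lambda>x. \<sigma> * infdist x (- \<Omega>))"
  \<comment> \<open>The distance to an empty set is 0 by convention; boundedness of \<Omega>
    excludes this degenerate case.\<close>
  have ne: "- \<Omega> \<noteq> {}"
    using \<Omega>(2) not_bounded_UNIV by (metis Compl_empty_eq double_compl)
  have v: "\<sigma>-lipschitz_on UNIV v" "v \<in> W1inf0 \<Omega>"
    using W1inf0_infdist[OF ne, of \<sigma>] \<open>\<sigma> > 0\<close> by (auto simp: v_def)
  have "?E v x = 0" for x
    using norm_grad_le_lipschitz[OF v(1), of x] by (intro energy_density_flat[OF f]) auto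
  then have Iv: "I_Omega f \<Omega> v = - (\<integral>x. v x \<partial>?M)"
    using I[OF v(2)] by simp
  have v_nn: "0 \<le> v x" for x
    using \<open>\<sigma> > 0\<close> by (simp add: v_def infdist_nonneg)
  have "(\<integral>x. v x \<partial>?M) \<noteq> 0"
  proof
    assume "(\<integral>x. v x \<partial>?M) = 0"
    then have ae: "AE x in ?M. v x = 0"
      using int[OF v(2)] v_nn by (subst (asm) integral_nonneg_eq_0_iff_AE) auto
    obtain x where x: "x \<in> \<Omega>" using \<Omega>(3) by blast
    have "v x = 0"
      by (rule continuous_AE_zero_on_open[OF \<Omega>(1) W1inf0_continuous[OF v(2)] ae x])
    then have "infdist x (- \<Omega>) = 0" using \<open>\<sigma> > 0\<close> by (simp add: v_def)
    then have "x \<in> - \<Omega>"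
      using in_closed_iff_infdist_zero[of "- \<Omega>" x] ne \<Omega>(1) by (simp add: closed_Compl)
    then show False using x by simp
  qed
  moreover have "0 \<le> (\<integral>x. v x \<partial>?M)"
    using v_nn by simp
  moreover have "I_Omega f \<Omega> u \<le> I_Omega f \<Omega> v"
    using u v(2) by (simp add: is_minimizer_def)
  \<comment> \<open>Neither \<open>u\<close> nor \<open>v\<close> has gradient energy, so comparing
    their energies compares their integrals.\<close>
  ultimately have pos: "0 < (\<integral>x. u x \<partial>?M)"
    using Iu Iv by linarith

  define m where "m = measure ?M (space ?M)"
  interpret finite_measure ?M
    using \<Omega> by (intro finite_measure_lebesgue_on) (simp add: lmeasurable_open)
  have m: "0 \<le> m" by (simp add: m_def)
  \<comment> \<open>Chosen so that the cost \<open>e * m\<close> stays below the integral of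
    \<open>u\<close>; the added 1 keeps the denominator positive.\<close>
  define e where "e = (\<integral>x. u x \<partial>?M) / (2 * (m + 1))"
  have e: "0 < e" "e * m < (\<integral>x. u x \<partial>?M)"
    using pos m by (auto simp: e_def field_simps intro: add_nonneg_pos)
  obtain t where t: "0 < t" "f ((1 + t) * \<sigma>) \<le> e * t"
    using energy_density_flat_tangent[OF f \<open>\<sigma> > 0\<close> e(1)] .
  \<comment> \<open>Scaling gains \<open>t\<close> times the integral of \<open>u\<close> in the
    linear term and costs at most \<open>t * (e * m)\<close> in gradient energy.\<close>
  let ?w = "\<lambda>x. (1 + t) * u x"
  have w: "?w \<in> W1inf0 \<Omega>" by (rule W1inf0_cmult[OF Wu])
  have "(\<integral>x. ?E ?w x \<partial>?M) \<le> (\<integral>x. e * t \<partial>?M)"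
  proof (rule integral_mono_AE)
    show "AE x in ?M. ?E ?w x \<le> e * t"
      using shallow W1inf0_differentiable_ae[OF Wu \<Omega>(1)]
    proof eventually_elim
      case (elim x)
      have "norm (grad ?w x) = (1 + t) * norm (grad u x)"
        using t by (simp add: grad_scale[OF elim(2)])
      also have "\<dots> \<le> (1 + t) * \<sigma>"
        using elim(1) t by (intro mult_left_mono) auto
      finally have "?E ?w x \<le> f ((1 + t) * \<sigma>)"
        by (intro energy_density_mono[OF f(1)]) auto
      then show ?case using t by linarith
    qed
  qed (use intE[OF w] in auto)
  also have "\<dots> = t * (e * m)" by (simp add: m_def)
  also have "\<dots> < t * (\<integral>x. u x \<partial>?M)"
    using e(2) t(1) by (intro mult_strict_left_mono) auto
  finally have "(\<integral>x. ?E ?w x \<partial>?M) < t * (\<integral>x. u x \<partial>?M)" .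
  moreover have "(\<integral>x. ?w x \<partial>?M) = (1 + t) * (\<integral>x. u x \<partial>?M)"
    by simp
  ultimately have "I_Omega f \<Omega> ?w < I_Omega f \<Omega> u"
    using I[OF w] Iu by (simp add: distrib_right)
  then show False
    using u w by (auto simp: is_minimizer_def not_less[symmetric])
qed

theorem theorem2p3:
  fixes \<Omega> :: "(real^'n) set" and f f' :: "real \<Rightarrow> real" and \<sigma> :: real
    and u :: "real^'n \<Rightarrow> real"
  assumes "open \<Omega>" "connected \<Omega>" "bounded \<Omega>" "\<Omega> \<noteq> {}"
    and "cond_f1 f f'" and "cond_f2 f f' \<sigma>" and "\<sigma> > 0"
    and "is_minimizer f \<Omega> u"
  shows "emeasure lebesgue {x \<in> \<Omega>. norm (grad u x) > \<sigma>} > 0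
         \<and> (\<forall>w. is_minimizer f \<Omega> w \<longrightarrow> w = u)"
proof (intro conjI allI impI)
  show "emeasure lebesgue {x \<in> \<Omega>. norm (grad u x) > \<sigma>} > 0"
    using minimizer_steep assms by blast
  fix w assume w: "is_minimizer f \<Omega> w"
  note le = minimizer_le_minimizer[OF assms(1,3,5,6)]
  show "w = u"
    using le[OF assms(8) w] le[OF w assms(8)] by (intro ext order_antisym)
qed

end
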